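(* Let $\widetilde{H}$ be the affine Hecke algebra of type $C_2$ with $q^2=-1$. Let $t\in T$ be a weight with $t|_Q=t_{q^2,1}$. Let $\mathbb{C}_{q^2,1}=\mathbb{C}v_t$ and $\mathbb{C}_{q^{-2},1}=\mathbb{C}v_{s_1t}$ be the $1$-dimensional $\widetilde{H}_{\{1\}}$-modules given by $X^\lambda v_t=t(X^\lambda)v_t$, $T_1v_t=qv_t$, and $X^\lambda v_{s_1t}=(s_1t)(X^\lambda)v_{s_1t}$, $T_1v_{s_1t}=-q^{-1}v_{s_1t}$, and let $$M=\widetilde{H}\otimes_{\widetilde{H}_{\{1\}}}\mathbb{C}_{q^2,1},\qquad N=\widetilde{H}\otimes_{\widetilde{H}_{\{1\}}}\mathbb{C}_{q^{-2},1}.$$ Then: (a) $M$ is irreducible. (b) With $v=T_1T_2v_t-qT_2v_t-v_t\in M$, the map $\phi:N\to M$, $hv_{s_1t}\mapsto hv$ for $h\in\widetilde{H}$, is a (well-defined) isomorphism of $\widetilde{H}$-modules. (c) Any irreducible $\widetilde{H}$-module $L$ with central character $t$ is isomorphic to $M$.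
   Context: The type $C_2$ root system has simple roots $\alpha_1,\alpha_2$ with $\langle\alpha_1,\alpha_2^\vee\rangle=-1$, $\langle\alpha_2,\alpha_1^\vee\rangle=-2$; $s_i\lambda=\lambda-\langle\lambda,\alpha_i^\vee\rangle\alpha_i$, and $W_0=\langle s_1,s_2\rangle$. Fundamental weights: $\omega_1=\alpha_1+\frac12\alpha_2$, $\omega_2=\alpha_1+\alpha_2$; $P=\mathbb{Z}\omega_1+\mathbb{Z}\omega_2$, $Q=\mathbb{Z}\alpha_1+\mathbb{Z}\alpha_2$. $X=\{X^\lambda\mid\lambda\in P\}$, $X^\lambda X^\mu=X^{\lambda+\mu}$. For $q\in\mathbb{C}^\times$, $\widetilde{H}$ is the $\mathbb{C}$-algebra generated by $T_1,T_2$ and $X^\lambda$ ($\lambda\in P$), with the group algebra $\mathbb{C}[X]$ a subalgebra, subject to $T_i^2=(q-q^{-1})T_i+1$, $T_1T_2T_1T_2=T_2T_1T_2T_1$, and $X^\lambda T_i=T_iX^{s_i\lambda}+(q-q^{-1})\frac{X^\lambda-X^{s_i\lambda}}{1-X^{-\alpha_i}}$. $\widetilde{H}_{\{i\}}$ is the subalgebra generated by $T_i$ and $\mathbb{C}[X]$. Weights are elements of $T=\mathrm{Hom}(X,\mathbb{C}^\times)$, with $W_0$-action $(wt)(X^\lambda)=t(X^{w^{-1}\lambda})$. For $t\in T$, $t|_Q$ denotes its restriction to $\{X^\lambda\mid\lambda\in Q\}$, and $t_{z,w}$ is the character of $\{X^\lambda\mid\lambda\in Q\}$ with $X^{\alpha_1}\mapsto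 z$, $X^{\alpha_2}\mapsto w$. For a finite-dimensional $\widetilde{H}$-module $M$, $M_t^{\mathrm{gen}}=\{m\mid\forall\lambda\ \exists k>0:(X^\lambda-t(X^\lambda))^km=0\}$, and $t$ is a weight of $M$ if $M_t^{\mathrm{gen}}\ne0$. The weights of an irreducible $\widetilde{H}$-module lie in a single $W_0$-orbit; this orbit (or any element of it) is called its central character. (Irreducible $\widetilde{H}$-modules are finite-dimensional.) *)

theory Defs
  imports
    Complex_Main
    "HOL-Library.Product_Plus"
    "HOL-Library.Poly_Mapping"
    "HOL-Algebra.Algebra"
    "HOL-Algebra.Algebraic_Closure_Type"
begin

section \<open>The root system of type \<open>C\<^sub>2\<close>\<close>

datatype node = Node1 | Node2

text \<open>The pair \<open>(a, b)\<close> stands for the weight \<open>a \<omega>\<^sub>1 + b \<omega>\<^sub>2\<close>, so that the pairing with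
  the simple coroots reads off the coordinates.\<close>

type_synonym wt = "int \<times> int"

definition wscale :: "int \<Rightarrow> wt \<Rightarrow> wt" where
  "wscale n l = (n * fst l, n * snd l)"

fun coroot_pairing :: "wt \<Rightarrow> node \<Rightarrow> int" where
  "coroot_pairing l Node1 = fst l"
| "coroot_pairing l Node2 = snd l"

fun sroot :: "node \<Rightarrow> wt" where
  "sroot Node1 = (2, -1)"
| "sroot Node2 = (-2, 2)"

lemma cartan_integers:
  "coroot_pairing (sroot Node1) Node1 = 2" "coroot_pairing (sroot Node1) Node2 = -1"
  "coroot_pairing (sroot Node2) Node1 = -2" "coroot_pairing (sroot Node2) Node2 = 2"
  by simp_all

lemma fundamental_weights:
  "wscale 2 (1, 0) = wscale 2 (sroot Node1) + sroot Node2"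
  "(0, 1) = sroot Node1 + sroot Node2"
  by (simp_all add: wscale_def)

definition srefl :: "node \<Rightarrow> wt \<Rightarrow> wt" where
  "srefl i l = l - wscale (coroot_pairing l i) (sroot i)"

text \<open>As the simple reflections are involutions, the monoid they generate is the group
  they generate.\<close>

inductive_set weyl :: "(wt \<Rightarrow> wt) set" where
  weyl_id: "id \<in> weyl"
| weyl_srefl: "w \<in> weyl \<Longrightarrow> srefl i \<circ> w \<in> weyl"

lemma srefl_srefl [simp]: "srefl i (srefl i l) = l"
  by (cases i; cases l) (simp_all add: srefl_def wscale_def)

text \<open>A homomorphism from the group of all \<open>X\<^sup>\<lambda>\<close> to the nonzero complex numbers is
  represented as a function of \<open>\<lambda>\<close>.\<close>

definition torus :: "(wt \<Rightarrow> complex) set" where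
  "torus = {t. (\<forall>l. t l \<noteq> 0) \<and> (\<forall>l m. t (l + m) = t l * t m)}"

definition weyl_act :: "(wt \<Rightarrow> wt) \<Rightarrow> (wt \<Rightarrow> complex) \<Rightarrow> (wt \<Rightarrow> complex)" where
  "weyl_act w t = (\<lambda>l. t (inv_into UNIV w l))"

definition weyl_orbit :: "(wt \<Rightarrow> complex) \<Rightarrow> (wt \<Rightarrow> complex) set" where
  "weyl_orbit t = (\<lambda>w. weyl_act w t) ` weyl"

text \<open>\<open>restricts_to t z w\<close>: the restriction of \<open>t\<close> to the root lattice is the character
  \<open>t\<^bsub>z,w\<^esub>\<close> with \<open>X\<^sup>\<alpha>\<^sup>1 \<mapsto> z\<close> and \<open>X\<^sup>\<alpha>\<^sup>2 \<mapsto> w\<close>.\<close>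

definition restricts_to :: "(wt \<Rightarrow> complex) \<Rightarrow> complex \<Rightarrow> complex \<Rightarrow> bool" where
  "restricts_to t z w \<longleftrightarrow>
     (\<forall>a b. t (wscale a (sroot Node1) + wscale b (sroot Node2)) = z powi a * w powi b)"


section \<open>The affine Hecke algebra\<close>

subsection \<open>The group algebra of the weight lattice\<close>

abbreviation ga_X :: "wt \<Rightarrow> (wt \<Rightarrow>\<^sub>0 complex)" where
  "ga_X l \<equiv> Poly_Mapping.single l 1"

text \<open>\<open>is_dem_quot i l f\<close>: \<open>f\<close> is the element
  \<open>(X\<^sup>\<lambda> - X\<^bsup>s\<^sub>i\<lambda>\<^esup>) / (1 - X\<^bsup>-\<alpha>\<^sub>i\<^esup>)\<close> of the group algebra. It exists and is unique.\<close>

definition is_dem_quot :: "node \<Rightarrow> wt \<Rightarrow> (wt \<Rightarrow>\<^sub>0 complex) \<Rightarrow> bool" where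
  "is_dem_quot i l f \<longleftrightarrow> f * (1 - ga_X (- sroot i)) = ga_X l - ga_X (srefl i l)"

lemma geometric_ga:
  "(\<Sum>k<n. ga_X (l - wscale (int k) a)) * (1 - ga_X (- a)) = ga_X l - ga_X (l - wscale (int n) a)"
proof (induction n)
  case 0
  then show ?case by (simp add: wscale_def flip: zero_prod_def)
next
  case (Suc n)
  have e: "l - wscale (int n) a - a = l - wscale (int (Suc n)) a"
    by (simp add: wscale_def prod_eq_iff algebra_simps)
  have "ga_X (l - wscale (int n) a) * (1 - ga_X (- a))
      = ga_X (l - wscale (int n) a) - ga_X (l - wscale (int (Suc n)) a)"
    by (simp only: right_diff_distrib mult_1_right mult_single add_uminus_conv_diff e)
  with Suc show ?case
    by (simp add: distrib_right)
qed

lemma ga_mult_cancel: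
  fixes g :: "wt \<Rightarrow>\<^sub>0 complex"
  assumes "g * (1 - ga_X (- sroot i)) = 0"
  shows "g = 0"
proof (rule ccontr)
  assume "g \<noteq> 0"
  define p where "p = (\<lambda>l::wt. if i = Node1 then fst l else snd l)"
  have p_add: "p (x + y) = p x + p y" for x y by (simp add: p_def)
  have p_root: "p (- sroot i) = -2" by (cases i) (simp_all add: p_def)
  have eq: "g = g * ga_X (- sroot i)"
    using assms by (simp add: right_diff_distrib)
  have fin: "finite (p ` Poly_Mapping.keys g)" by simp
  have ne: "p ` Poly_Mapping.keys g \<noteq> {}" using \<open>g \<noteq> 0\<close> by simp
  obtain x where x: "x \<in> Poly_Mapping.keys g" and px: "p x = Max (p ` Poly_Mapping.keys g)"
    using Max_in[OF fin ne] by auto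
  have "x \<in> Poly_Mapping.keys (g * ga_X (- sroot i))" using x eq by simp
  then obtain y where y: "y \<in> Poly_Mapping.keys g" and "x = y + - sroot i"
    using keys_mult[of g "ga_X (- sroot i)"] by (fastforce dest: subsetD simp del: split_paired_Ex)
  then have "p y = p x + 2" using p_add[of y "- sroot i"] p_root by simp
  moreover have "p y \<le> p x" using px fin y by simp
  ultimately show False by simp
qed

lemma ex1_dem_quot: "\<exists>!f. is_dem_quot i l f"
proof (rule ex_ex1I)
  define n where "n = coroot_pairing l i"
  show "\<exists>f. is_dem_quot i l f"
  proof (cases "n \<ge> 0")
    case True
    then have "srefl i l = l - wscale (int (nat n)) (sroot i)"
      by (simp add: srefl_def n_def)
    then show ?thesis
      using geometric_ga[where n = "nat n" and l = l and a = "sroot i"] unfolding is_dem_quot_def by metis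
  next
    case False
    let ?f = "\<Sum>k<nat (- n). ga_X (srefl i l - wscale (int k) (sroot i))"
    have "l = srefl i l - wscale (int (nat (- n))) (sroot i)"
      using False by (simp add: srefl_def n_def wscale_def prod_eq_iff)
    then have "?f * (1 - ga_X (- sroot i)) = ga_X (srefl i l) - ga_X l"
      using geometric_ga[where n = "nat (- n)" and l = "srefl i l" and a = "sroot i"] by metis
    then have "is_dem_quot i l (- ?f)"
      unfolding is_dem_quot_def by (simp only: mult_minus_left minus_diff_eq)
    then show ?thesis ..
  qed
next
  fix f g assume "is_dem_quot i l f" "is_dem_quot i l g"
  then have "(f - g) * (1 - ga_X (- sroot i)) = 0"
    by (simp add: is_dem_quot_def left_diff_distrib)
  then show "f = g" using ga_mult_cancel by fastforce
qed


subsection \<open>Generators and relations\<close>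

datatype gen = GenT node | GenX wt

text \<open>Words form the free monoid under concatenation; the free algebra is its monoid
  algebra, with the convolution product of finitely supported functions.\<close>

instantiation list :: (type) monoid_add
begin
definition zero_list :: "'a list" where "zero_list = []"
definition plus_list :: "'a list \<Rightarrow> 'a list \<Rightarrow> 'a list" where "plus_list = (@)"
instance by standard (simp_all add: zero_list_def plus_list_def)
end

type_synonym free_alg = "gen list \<Rightarrow>\<^sub>0 complex"

definition free_scal :: "complex \<Rightarrow> free_alg" where
  "free_scal c = Poly_Mapping.single [] c"

definition free_T :: "node \<Rightarrow> free_alg" where
  "free_T i = Poly_Mapping.single [GenT i] 1"

definition free_X :: "wt \<Rightarrow> free_alg" where
  "free_X l = Poly_Mapping.single [GenX l] 1"

definition free_ga :: "(wt \<Rightarrow>\<^sub>0 complex) \<Rightarrow> free_alg" where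
  "free_ga f = (\<Sum>l\<in>Poly_Mapping.keys f. free_scal (Poly_Mapping.lookup f l) * free_X l)"

definition hecke_relators :: "complex \<Rightarrow> free_alg set" where
  "hecke_relators q =
     {free_X 0 - 1}
   \<union> {free_X l * free_X m - free_X (l + m) | l m. True}
   \<union> {free_T i * free_T i - (free_scal (q - inverse q) * free_T i + 1) | i. True}
   \<union> {free_T Node1 * free_T Node2 * free_T Node1 * free_T Node2
        - free_T Node2 * free_T Node1 * free_T Node2 * free_T Node1}
   \<union> {free_X l * free_T i
        - (free_T i * free_X (srefl i l) + free_scal (q - inverse q) * free_ga f) | l i f.
        is_dem_quot i l f}"

abbreviation free_ring :: "free_alg ring" where
  "free_ring \<equiv> ring_of_type_algebra"

definition hecke_ideal :: "complex \<Rightarrow> free_alg set" where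
  "hecke_ideal q = genideal free_ring (hecke_relators q)"

type_synonym hecke_elt = "free_alg set"

definition hecke :: "complex \<Rightarrow> hecke_elt ring" where
  "hecke q = free_ring Quot (hecke_ideal q)"

definition hecke_cls :: "complex \<Rightarrow> free_alg \<Rightarrow> hecke_elt" where
  "hecke_cls q a = hecke_ideal q +>\<^bsub>free_ring\<^esub> a"

definition hscal :: "complex \<Rightarrow> complex \<Rightarrow> hecke_elt" where
  "hscal q c = hecke_cls q (free_scal c)"

definition hT :: "complex \<Rightarrow> node \<Rightarrow> hecke_elt" where
  "hT q i = hecke_cls q (free_T i)"

definition hX :: "complex \<Rightarrow> wt \<Rightarrow> hecke_elt" where
  "hX q l = hecke_cls q (free_X l)"

text \<open>The scalars are among the generators of the subring, which makes it a subalgebra.\<close>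

definition parabolic :: "complex \<Rightarrow> node \<Rightarrow> hecke_elt set" where
  "parabolic q i = generate_ring (hecke q) (range (hscal q) \<union> {hT q i} \<union> range (hX q))"

abbreviation parabolic_ring :: "complex \<Rightarrow> node \<Rightarrow> hecke_elt ring" where
  "parabolic_ring q i \<equiv> (hecke q)\<lparr>carrier := parabolic q i\<rparr>"


section \<open>Modules over noncommutative rings\<close>

text \<open>The library locale \<^locale>\<open>module\<close> requires a commutative ring; otherwise the axioms
  are the same. The fields \<open>mult\<close> and \<open>one\<close> of the module record
  play no role. For an algebra over the complex numbers, the vector space structure of a
  module is the action of the scalars of the algebra, so ring-theoretic submodules,
  homomorphisms and tensor products are the ones over the algebra.\<close>

locale left_module = R?: ring R + M?: abelian_group M
  for R :: "('a, 'b) ring_scheme" (structure) and M :: "('a, 'm, 'c) module_scheme" (structure) +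
  assumes lm_smult_closed:
      "\<lbrakk>a \<in> carrier R; x \<in> carrier M\<rbrakk> \<Longrightarrow> a \<odot>\<^bsub>M\<^esub> x \<in> carrier M"
    and lm_smult_l_distr:
      "\<lbrakk>a \<in> carrier R; b \<in> carrier R; x \<in> carrier M\<rbrakk> \<Longrightarrow>
        (a \<oplus> b) \<odot>\<^bsub>M\<^esub> x = a \<odot>\<^bsub>M\<^esub> x \<oplus>\<^bsub>M\<^esub> b \<odot>\<^bsub>M\<^esub> x"
    and lm_smult_r_distr:
      "\<lbrakk>a \<in> carrier R; x \<in> carrier M; y \<in> carrier M\<rbrakk> \<Longrightarrow>
        a \<odot>\<^bsub>M\<^esub> (x \<oplus>\<^bsub>M\<^esub> y) = a \<odot>\<^bsub>M\<^esub> x \<oplus>\<^bsub>M\<^esub> a \<odot>\<^bsub>M\<^esub> y"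
    and lm_smult_assoc:
      "\<lbrakk>a \<in> carrier R; b \<in> carrier R; x \<in> carrier M\<rbrakk> \<Longrightarrow>
        (a \<otimes> b) \<odot>\<^bsub>M\<^esub> x = a \<odot>\<^bsub>M\<^esub> (b \<odot>\<^bsub>M\<^esub> x)"
    and lm_smult_one:
      "x \<in> carrier M \<Longrightarrow> \<one> \<odot>\<^bsub>M\<^esub> x = x"

definition irreducible_module :: "'a ring \<Rightarrow> ('a, 'm) module \<Rightarrow> bool" where
  "irreducible_module R M \<longleftrightarrow>
     left_module R M \<and> carrier M \<noteq> {\<zero>\<^bsub>M\<^esub>} \<and>
     (\<forall>U. submodule U R M \<longrightarrow> U = {\<zero>\<^bsub>M\<^esub>} \<or> U = carrier M)"

definition module_iso :: "'a ring \<Rightarrow> ('a, 'm) module \<Rightarrow> ('a, 'n) module \<Rightarrow> ('m \<Rightarrow> 'n) set" where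
  "module_iso R M N =
     {f. bij_betw f (carrier M) (carrier N) \<and>
         (\<forall>x\<in>carrier M. \<forall>y\<in>carrier M. f (x \<oplus>\<^bsub>M\<^esub> y) = f x \<oplus>\<^bsub>N\<^esub> f y) \<and>
         (\<forall>a\<in>carrier R. \<forall>x\<in>carrier M. f (a \<odot>\<^bsub>M\<^esub> x) = a \<odot>\<^bsub>N\<^esub> f x)}"

subsection \<open>Extension of scalars\<close>

text \<open>For a subring \<open>S\<close> of \<open>R\<close> and a left \<open>S\<close>-module \<open>V\<close>, the left \<open>R\<close>-module \<open>R \<otimes>\<^sub>S V\<close> is the
  free abelian group on \<open>R \<times> V\<close> modulo the subgroup generated by the biadditivity and
  balancing relations, with \<open>R\<close> acting on the first factor.\<close>

definition tensor_free :: "'a ring \<Rightarrow> ('a, 'v) module \<Rightarrow> ('a \<times> 'v \<Rightarrow>\<^sub>0 int) monoid" where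
  "tensor_free R V = free_Abelian_group (carrier R \<times> carrier V)"

definition tensor_relators :: "'a ring \<Rightarrow> 'a set \<Rightarrow> ('a, 'v) module \<Rightarrow> ('a \<times> 'v \<Rightarrow>\<^sub>0 int) set" where
  "tensor_relators R S V =
     {frag_of (h \<oplus>\<^bsub>R\<^esub> h', v) - frag_of (h, v) - frag_of (h', v) | h h' v.
        h \<in> carrier R \<and> h' \<in> carrier R \<and> v \<in> carrier V}
   \<union> {frag_of (h, v \<oplus>\<^bsub>V\<^esub> v') - frag_of (h, v) - frag_of (h, v') | h v v'.
        h \<in> carrier R \<and> v \<in> carrier V \<and> v' \<in> carrier V}
   \<union> {frag_of (h \<otimes>\<^bsub>R\<^esub> s, v) - frag_of (h, s \<odot>\<^bsub>V\<^esub> v) | h s v.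
        h \<in> carrier R \<and> s \<in> S \<and> v \<in> carrier V}"

definition tensor_sub :: "'a ring \<Rightarrow> 'a set \<Rightarrow> ('a, 'v) module \<Rightarrow> ('a \<times> 'v \<Rightarrow>\<^sub>0 int) set" where
  "tensor_sub R S V = generate (tensor_free R V) (tensor_relators R S V)"

definition tensor_module ::
    "'a ring \<Rightarrow> 'a set \<Rightarrow> ('a, 'v) module \<Rightarrow> ('a, ('a \<times> 'v \<Rightarrow>\<^sub>0 int) set) module" where
  "tensor_module R S V =
     \<lparr>carrier = carrier (tensor_free R V Mod tensor_sub R S V),
      monoid.mult = undefined, monoid.one = undefined,
      ring.zero = \<one>\<^bsub>tensor_free R V Mod tensor_sub R S V\<^esub>,
      ring.add = (\<otimes>\<^bsub>tensor_free R V Mod tensor_sub R S V\<^esub>),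
      module.smult = (\<lambda>r C. \<Union>c\<in>C. tensor_sub R S V #>\<^bsub>tensor_free R V\<^esub>
                 frag_extend (\<lambda>(h, v). frag_of (r \<otimes>\<^bsub>R\<^esub> h, v)) c)\<rparr>"

definition pure_tensor ::
    "'a ring \<Rightarrow> 'a set \<Rightarrow> ('a, 'v) module \<Rightarrow> 'a \<Rightarrow> 'v \<Rightarrow> ('a \<times> 'v \<Rightarrow>\<^sub>0 int) set" where
  "pure_tensor R S V h v = tensor_sub R S V #>\<^bsub>tensor_free R V\<^esub> frag_of (h, v)"


section \<open>Modules over the affine Hecke algebra\<close>

subsection \<open>Node1-dimensional modules and their induced modules\<close>

text \<open>The algebra homomorphism from the subalgebra generated by \<open>T\<^sub>i\<close> and the \<open>X\<^sup>\<lambda>\<close> to the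
  complex numbers with \<open>X\<^sup>\<lambda> \<mapsto> t(X\<^sup>\<lambda>)\<close> and \<open>T\<^sub>i \<mapsto> c\<close>. There is at most one, since its values on
  generators are prescribed, and there is one exactly if these values respect the
  relations between \<open>T\<^sub>i\<close> and the \<open>X\<^sup>\<lambda>\<close>; for \<open>t\<close> in the torus this is the case if
  \<open>t(X\<^bsup>\<alpha>\<^sub>i\<^esup>) = q\<^sup>2\<close> and \<open>c = q\<close>, and if \<open>t(X\<^bsup>\<alpha>\<^sub>i\<^esup>) = q\<^bsup>-2\<^esup>\<close> and \<open>c = -q\<^bsup>-1\<^esup>\<close>.\<close>

definition line_char :: "complex \<Rightarrow> node \<Rightarrow> (wt \<Rightarrow> complex) \<Rightarrow> complex \<Rightarrow> hecke_elt \<Rightarrow> complex" where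
  "line_char q i t c = (THE \<chi>.
     \<chi> \<in> ring_hom (parabolic_ring q i) (ring_of_type_algebra :: complex ring) \<and>
     \<chi> \<in> extensional (parabolic q i) \<and>
     (\<forall>a. \<chi> (hscal q a) = a) \<and> (\<forall>l. \<chi> (hX q l) = t l) \<and> \<chi> (hT q i) = c)"

text \<open>The one-dimensional module is realised on the complex numbers, with basis vector \<open>1\<close>.\<close>

definition line_module :: "complex \<Rightarrow> node \<Rightarrow> (wt \<Rightarrow> complex) \<Rightarrow> complex \<Rightarrow> (hecke_elt, complex) module"
  where "line_module q i t c =
     \<lparr>carrier = UNIV, monoid.mult = (*), monoid.one = 1, ring.zero = 0, ring.add = (+),
      module.smult = (\<lambda>h z. line_char q i t c h * z)\<rparr>"

type_synonym induced_elt = "(hecke_elt \<times> complex \<Rightarrow>\<^sub>0 int) set"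

definition induced ::
    "complex \<Rightarrow> node \<Rightarrow> (wt \<Rightarrow> complex) \<Rightarrow> complex \<Rightarrow> (hecke_elt, induced_elt) module" where
  "induced q i t c = tensor_module (hecke q) (parabolic q i) (line_module q i t c)"

definition induced_gen :: "complex \<Rightarrow> node \<Rightarrow> (wt \<Rightarrow> complex) \<Rightarrow> complex \<Rightarrow> induced_elt" where
  "induced_gen q i t c =
     pure_tensor (hecke q) (parabolic q i) (line_module q i t c) \<one>\<^bsub>hecke q\<^esub> 1"

subsection \<open>Weights and central characters\<close>

definition gen_weight_space :: "complex \<Rightarrow> (hecke_elt, 'm) module \<Rightarrow> (wt \<Rightarrow> complex) \<Rightarrow> 'm set" where
  "gen_weight_space q M t =
     {m \<in> carrier M. \<forall>l. \<exists>k>0.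
        ((hX q l \<ominus>\<^bsub>hecke q\<^esub> hscal q (t l)) [^]\<^bsub>hecke q\<^esub> (k::nat)) \<odot>\<^bsub>M\<^esub> m = \<zero>\<^bsub>M\<^esub>}"

definition weights :: "complex \<Rightarrow> (hecke_elt, 'm) module \<Rightarrow> (wt \<Rightarrow> complex) set" where
  "weights q M = {t \<in> torus. gen_weight_space q M t \<noteq> {\<zero>\<^bsub>M\<^esub>}}"

definition has_central_character :: "complex \<Rightarrow> (hecke_elt, 'm) module \<Rightarrow> (wt \<Rightarrow> complex) \<Rightarrow> bool" where
  "has_central_character q M t \<longleftrightarrow> weights q M \<noteq> {} \<and> weights q M \<subseteq> weyl_orbit t"

end

theory Submission
  imports Defs
begin

text \<open>
  As \<open>q\<^sup>2 = -1\<close>, we have \<open>q\<^sup>-\<^sup>1 = -q\<close>, so the quadratic relation reads \<open>(T\<^sub>i - q)\<^sup>2 = 0\<close> and \<open>T\<^sub>1\<close> acts by the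
  same scalar \<open>q\<close> on both one-dimensional modules. The weight \<open>t\<close> is fixed by \<open>s\<^sub>2\<close> and differs from
  \<open>s\<^sub>1t\<close> only by the sign of its value at \<open>X\<^bsup>\<omega>\<^sub>1\<^esup>\<close>, and \<open>s\<^sub>1t\<close> has the same restriction to the root lattice.
  The orbit is \<open>{t, s\<^sub>1t}\<close>, and its two elements play symmetric roles.

  Let \<open>\<chi>\<close> be one of them, and let \<open>x\<close> be a vector of weight \<open>\<chi>\<close> with \<open>T\<^sub>1 x = q x\<close> in an arbitrary module.
  Then \<open>y = T\<^sub>1 T\<^sub>2 x - q T\<^sub>2 x - x\<close> satisfies \<open>T\<^sub>1 y = q y\<close> and has weight \<open>s\<^sub>1\<chi>\<close>, and by the braid relation
  the same construction applied to \<open>y\<close> returns \<open>x\<close>. So the span of \<open>x\<close>, \<open>T\<^sub>2 x\<close>, \<open>y\<close>, \<open>T\<^sub>2 y\<close> is a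
  submodule, and the generators act on these four vectors by formulas that do not depend on the
  module. These formulas define a representation on \<open>\<complex>\<^sup>4\<close> (\<open>left_module_model\<close>), which is therefore the
  universal module generated by such a vector (\<open>comb_hom\<close>). The induced module has the same universal
  property, whence \<open>induced_iso\<close>. The explicit model is also what shows that the characters
  of the parabolic subalgebra exist and that the induced module does not collapse.

  The claims are now visible in the model. It is irreducible (\<open>irreducible_model\<close>), because \<open>X\<^bsup>\<omega>\<^sub>1\<^esup>\<close>
  separates the two weights, \<open>X\<^bsup>\<omega>\<^sub>2\<^esup> + 1\<close> is nilpotent with image spanned by \<open>x\<close> and \<open>y\<close>, and each of these two
  generates. Exchanging the pairs \<open>(x, T\<^sub>2 x)\<close> and \<open>(y, T\<^sub>2 y)\<close> identifies the models for \<open>\<chi>\<close> and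
  \<open>s\<^sub>1\<chi>\<close> (\<open>swap4_iso\<close>), which is the isomorphism \<open>N \<rightarrow> M\<close> sending the generator to \<open>v\<close>. Finally, a simple
  module \<open>L\<close> with central character \<open>t\<close> contains a common eigenvector \<open>u\<close> of the \<open>X\<^sup>\<lambda>\<close> whose weight lies in
  the orbit; either \<open>T\<^sub>1 u = q u\<close>, or \<open>(T\<^sub>1 - q) u\<close> is an eigenvector for \<open>s\<^sub>1\<close> of that weight which \<open>T\<^sub>1 - q\<close>
  kills (\<open>weight_vector_exists\<close>). Either way one of the two models maps to \<open>L\<close>, isomorphically by
  Schur's lemma.
\<close>

section \<open>Modules over a noncommutative ring\<close>

context left_module
begin

lemma smult_r_null [simp]: "a \<in> carrier R \<Longrightarrow> a \<odot>\<^bsub>M\<^esub> \<zero>\<^bsub>M\<^esub> = \<zero>\<^bsub>M\<^esub>"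
  using lm_smult_r_distr[of a "\<zero>\<^bsub>M\<^esub>" "\<zero>\<^bsub>M\<^esub>"] lm_smult_closed[of a "\<zero>\<^bsub>M\<^esub>"]
  by (simp add: M.add.r_cancel_one')

lemma smult_l_null [simp]: "x \<in> carrier M \<Longrightarrow> \<zero> \<odot>\<^bsub>M\<^esub> x = \<zero>\<^bsub>M\<^esub>"
  using lm_smult_l_distr[of "\<zero>" "\<zero>" x] lm_smult_closed[of "\<zero>" x]
  by (simp add: M.add.r_cancel_one')

lemma smult_r_minus: "a \<in> carrier R \<Longrightarrow> x \<in> carrier M \<Longrightarrow> a \<odot>\<^bsub>M\<^esub> (\<ominus>\<^bsub>M\<^esub> x) = \<ominus>\<^bsub>M\<^esub> (a \<odot>\<^bsub>M\<^esub> x)"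
  using lm_smult_r_distr[of a x "\<ominus>\<^bsub>M\<^esub> x"]
  by (metis M.minus_equality M.a_inv_closed M.l_neg M.r_neg M.add.inv_unique' lm_smult_closed smult_r_null)

lemma smult_l_minus: "a \<in> carrier R \<Longrightarrow> x \<in> carrier M \<Longrightarrow> (\<ominus> a) \<odot>\<^bsub>M\<^esub> x = \<ominus>\<^bsub>M\<^esub> (a \<odot>\<^bsub>M\<^esub> x)"
  using lm_smult_l_distr[of a "\<ominus> a" x]
  by (metis M.add.inv_unique' M.minus_equality R.a_inv_closed R.l_neg R.r_neg lm_smult_closed lm_smult_l_distr smult_l_null)

lemma submoduleI:
  assumes "H \<subseteq> carrier M" "\<zero>\<^bsub>M\<^esub> \<in> H" "\<And>x y. x \<in> H \<Longrightarrow> y \<in> H \<Longrightarrow> x \<oplus>\<^bsub>M\<^esub> y \<in> H"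
    and "\<And>a x. a \<in> carrier R \<Longrightarrow> x \<in> H \<Longrightarrow> a \<odot>\<^bsub>M\<^esub> x \<in> H"
  shows "submodule H R M"
proof (intro submodule.intro subgroup.intro submodule_axioms.intro)
  fix x assume x: "x \<in> H"
  have "(\<ominus> \<one>) \<odot>\<^bsub>M\<^esub> x = \<ominus>\<^bsub>M\<^esub> x"
    using x assms(1) by (subst smult_l_minus) (auto simp: lm_smult_one)
  then show "inv\<^bsub>add_monoid M\<^esub> x \<in> H"
    using assms(4)[of "\<ominus> \<one>" x] x by (simp add: a_inv_def)
qed (use assms in auto)

end

lemma submodule_zero: "submodule U R M \<Longrightarrow> \<zero>\<^bsub>M\<^esub> \<in> U"
  using subgroup.one_closed[OF submodule.axioms(1)] by fastforce

lemma submodule_add: "submodule U R M \<Longrightarrow> x \<in> U \<Longrightarrow> y \<in> U \<Longrightarrow> x \<oplus>\<^bsub>M\<^esub> y \<in> U"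
  using subgroup.m_closed[OF submodule.axioms(1)] by fastforce

lemma submodule_subset: "submodule U R M \<Longrightarrow> U \<subseteq> carrier M"
  using subgroup.subset[OF submodule.axioms(1)] by fastforce

definition left_module_hom :: "'a ring \<Rightarrow> ('a, 'm) module \<Rightarrow> ('a, 'n) module \<Rightarrow> ('m \<Rightarrow> 'n) set" where
  "left_module_hom R M N =
     {f \<in> carrier M \<rightarrow> carrier N.
         (\<forall>x\<in>carrier M. \<forall>y\<in>carrier M. f (x \<oplus>\<^bsub>M\<^esub> y) = f x \<oplus>\<^bsub>N\<^esub> f y) \<and>
         (\<forall>a\<in>carrier R. \<forall>x\<in>carrier M. f (a \<odot>\<^bsub>M\<^esub> x) = a \<odot>\<^bsub>N\<^esub> f x)}"

lemma left_module_homI: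
  assumes "\<And>x. x \<in> carrier M \<Longrightarrow> f x \<in> carrier N"
    and "\<And>x y. x \<in> carrier M \<Longrightarrow> y \<in> carrier M \<Longrightarrow> f (x \<oplus>\<^bsub>M\<^esub> y) = f x \<oplus>\<^bsub>N\<^esub> f y"
    and "\<And>a x. a \<in> carrier R \<Longrightarrow> x \<in> carrier M \<Longrightarrow> f (a \<odot>\<^bsub>M\<^esub> x) = a \<odot>\<^bsub>N\<^esub> f x"
  shows "f \<in> left_module_hom R M N"
  using assms by (auto simp: left_module_hom_def)

lemma left_module_hom_closed: "f \<in> left_module_hom R M N \<Longrightarrow> x \<in> carrier M \<Longrightarrow> f x \<in> carrier N"
  and left_module_hom_add: "f \<in> left_module_hom R M N \<Longrightarrow> x \<in> carrier M \<Longrightarrow> y \<in> carrier M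
        \<Longrightarrow> f (x \<oplus>\<^bsub>M\<^esub> y) = f x \<oplus>\<^bsub>N\<^esub> f y"
  and left_module_hom_smult: "f \<in> left_module_hom R M N \<Longrightarrow> a \<in> carrier R \<Longrightarrow> x \<in> carrier M
        \<Longrightarrow> f (a \<odot>\<^bsub>M\<^esub> x) = a \<odot>\<^bsub>N\<^esub> f x"
  by (auto simp: left_module_hom_def)

lemma module_iso_iff: "f \<in> module_iso R M N \<longleftrightarrow> f \<in> left_module_hom R M N \<and> bij_betw f (carrier M) (carrier N)"
  by (auto simp: module_iso_def left_module_hom_def bij_betw_def)

lemma left_module_hom_comp:
  assumes "f \<in> left_module_hom R L M" "g \<in> left_module_hom R M N"
  shows "g \<circ> f \<in> left_module_hom R L N"
  using assms by (auto simp: left_module_hom_def Pi_iff)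

lemma module_iso_comp:
  "f \<in> module_iso R L M \<Longrightarrow> g \<in> module_iso R M N \<Longrightarrow> g \<circ> f \<in> module_iso R L N"
  unfolding module_iso_iff using left_module_hom_comp bij_betw_trans by blast

lemma left_module_hom_zero:
  assumes "left_module R M" "left_module R N" "f \<in> left_module_hom R M N"
  shows "f \<zero>\<^bsub>M\<^esub> = \<zero>\<^bsub>N\<^esub>"
proof -
  interpret M: left_module R M by fact
  interpret N: left_module R N by fact
  have "f (\<zero>\<^bsub>R\<^esub> \<odot>\<^bsub>M\<^esub> \<zero>\<^bsub>M\<^esub>) = \<zero>\<^bsub>R\<^esub> \<odot>\<^bsub>N\<^esub> f \<zero>\<^bsub>M\<^esub>"
    by (rule left_module_hom_smult[OF assms(3)]) auto
  then show ?thesis using left_module_hom_closed[OF assms(3)] by simp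
qed

lemma left_module_hom_minus:
  assumes "left_module R M" "left_module R N" "f \<in> left_module_hom R M N" "x \<in> carrier M"
  shows "f (\<ominus>\<^bsub>M\<^esub> x) = \<ominus>\<^bsub>N\<^esub> f x"
proof -
  interpret M: left_module R M by fact
  interpret N: left_module R N by fact
  have "f (\<ominus>\<^bsub>M\<^esub> x) \<oplus>\<^bsub>N\<^esub> f x = \<zero>\<^bsub>N\<^esub>"
    using left_module_hom_add[OF assms(3), of "\<ominus>\<^bsub>M\<^esub> x" x] assms(4) left_module_hom_zero[OF assms(1-3)]
    by (simp add: M.M.l_neg)
  then show ?thesis
    using N.M.minus_equality left_module_hom_closed[OF assms(3)] assms(4) by (metis M.M.a_inv_closed)
qed

lemma left_module_hom_diff:
  assumes "left_module R M" "left_module R N" "f \<in> left_module_hom R M N" "x \<in> carrier M" "y \<in> carrier M"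
  shows "f (x \<ominus>\<^bsub>M\<^esub> y) = f x \<ominus>\<^bsub>N\<^esub> f y"
proof -
  interpret M: left_module R M by fact
  show ?thesis
    using assms by (simp add: a_minus_def left_module_hom_add[OF assms(3)] left_module_hom_minus[OF assms(1-3)])
qed

lemma module_iso_inv:
  assumes "left_module R M" "f \<in> module_iso R M N"
  shows "inv_into (carrier M) f \<in> module_iso R N M"
proof -
  interpret M: left_module R M by fact
  have bij: "bij_betw f (carrier M) (carrier N)" and hom: "f \<in> left_module_hom R M N"
    using assms by (auto simp: module_iso_iff)
  have g: "inv_into (carrier M) f y \<in> carrier M" "f (inv_into (carrier M) f y) = y" if "y \<in> carrier N" for y
    using bij that by (auto simp: bij_betw_def inv_into_into f_inv_into_f)
  have eq: "inv_into (carrier M) f y = x" if "x \<in> carrier M" "f x = y" for x y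
    using bij that by (auto simp: bij_betw_def)
  have "inv_into (carrier M) f \<in> left_module_hom R N M"
    by (intro left_module_homI eq)
      (auto simp: g left_module_hom_add[OF hom] left_module_hom_smult[OF hom] M.lm_smult_closed)
  then show ?thesis using bij by (simp add: module_iso_iff bij_betw_inv_into)
qed

lemma submodule_image:
  assumes "left_module R M" "left_module R N" "f \<in> left_module_hom R M N" "submodule U R M"
  shows "submodule (f ` U) R N"
proof -
  interpret N: left_module R N by fact
  note U = submodule_subset[OF assms(4)]
  show ?thesis
  proof (rule N.submoduleI)
    show "f ` U \<subseteq> carrier N" using U left_module_hom_closed[OF assms(3)] by blast
    show "\<zero>\<^bsub>N\<^esub> \<in> f ` U"
      using left_module_hom_zero[OF assms(1-3)] submodule_zero[OF assms(4)] by (metis imageI)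
    show "x \<oplus>\<^bsub>N\<^esub> y \<in> f ` U" if "x \<in> f ` U" "y \<in> f ` U" for x y
      using that U left_module_hom_add[OF assms(3)] submodule_add[OF assms(4)] by (smt (verit) imageE imageI subsetD)
    show "a \<odot>\<^bsub>N\<^esub> x \<in> f ` U" if "a \<in> carrier R" "x \<in> f ` U" for a x
      using that U left_module_hom_smult[OF assms(3)] submodule.smult_closed[OF assms(4)]
      by (smt (verit) imageE imageI subsetD)
  qed
qed

lemma submodule_kernel:
  assumes "left_module R M" "left_module R N" "f \<in> left_module_hom R M N"
  shows "submodule {x \<in> carrier M. f x = \<zero>\<^bsub>N\<^esub>} R M"
proof -
  interpret M: left_module R M by fact
  interpret N: left_module R N by fact
  show ?thesis
    by (rule M.submoduleI)
      (auto simp: left_module_hom_add[OF assms(3)] left_module_hom_smult[OF assms(3)] M.lm_smult_closed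
        left_module_hom_zero[OF assms])
qed

lemma submodule_carrier:
  assumes "left_module R M"
  shows "submodule (carrier M) R M"
proof -
  interpret M: left_module R M by fact
  show ?thesis by (rule M.submoduleI) (auto simp: M.lm_smult_closed)
qed

lemma irreducible_hom_inj:
  assumes M: "irreducible_module R M" and lN: "left_module R N"
    and f: "f \<in> left_module_hom R M N" and x: "x \<in> carrier M" "f x \<noteq> \<zero>\<^bsub>N\<^esub>"
  shows "inj_on f (carrier M)"
proof (rule inj_onI)
  have lM: "left_module R M" using M by (simp add: irreducible_module_def)
  interpret M: left_module R M by fact
  interpret N: left_module R N by fact
  have ker: "{x \<in> carrier M. f x = \<zero>\<^bsub>N\<^esub>} = {\<zero>\<^bsub>M\<^esub>}"
    using submodule_kernel[OF lM lN f] M x unfolding irreducible_module_def by blast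
  fix y z assume yz: "y \<in> carrier M" "z \<in> carrier M" "f y = f z"
  then have "f (y \<ominus>\<^bsub>M\<^esub> z) = \<zero>\<^bsub>N\<^esub>"
    using left_module_hom_diff[OF lM lN f] left_module_hom_closed[OF f] by (simp add: a_minus_def N.M.r_neg)
  then have "y \<ominus>\<^bsub>M\<^esub> z = \<zero>\<^bsub>M\<^esub>" using ker yz by blast
  then show "y = z" using yz by (metis a_minus_def M.M.minus_equality M.M.minus_minus M.M.a_inv_closed)
qed

text \<open>Schur's lemma: kernel and image of the homomorphism are submodules.\<close>

lemma irreducible_hom_is_iso:
  assumes M: "irreducible_module R M" and N: "irreducible_module R N"
    and f: "f \<in> left_module_hom R M N" and x: "x \<in> carrier M" "f x \<noteq> \<zero>\<^bsub>N\<^esub>"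
  shows "f \<in> module_iso R M N"
proof -
  have lM: "left_module R M" and lN: "left_module R N"
    using M N by (auto simp: irreducible_module_def)
  have "f ` carrier M = carrier N"
    using submodule_image[OF lM lN f submodule_carrier[OF lM]] N x unfolding irreducible_module_def by blast
  then show ?thesis using f irreducible_hom_inj[OF M lN f x] by (simp add: module_iso_iff bij_betw_def)
qed

lemma irreducible_module_iso:
  assumes lM: "left_module R M" and f: "f \<in> module_iso R M N" and N: "irreducible_module R N"
  shows "irreducible_module R M"
proof -
  have lN: "left_module R N" using N by (simp add: irreducible_module_def)
  interpret M: left_module R M by fact
  have hom: "f \<in> left_module_hom R M N" and bij: "bij_betw f (carrier M) (carrier N)"
    using f by (auto simp: module_iso_iff)
  note inj = bij_betw_imp_inj_on[OF bij] and img = bij_betw_imp_surj_on[OF bij]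
  have f0: "f ` {\<zero>\<^bsub>M\<^esub>} = {\<zero>\<^bsub>N\<^esub>}" using left_module_hom_zero[OF lM lN hom] by simp
  have "U = {\<zero>\<^bsub>M\<^esub>} \<or> U = carrier M" if U: "submodule U R M" for U
  proof -
    have "f ` U = f ` {\<zero>\<^bsub>M\<^esub>} \<or> f ` U = f ` carrier M"
      using submodule_image[OF lM lN hom U] N f0 img by (simp add: irreducible_module_def)
    then show ?thesis
      using inj_on_image_eq_iff[OF inj] submodule_subset[OF U] by (metis M.M.zero_closed empty_subsetI insert_subset subset_refl)
  qed
  moreover have "carrier M \<noteq> {\<zero>\<^bsub>M\<^esub>}"
    using N f0 img by (metis irreducible_module_def)
  ultimately show ?thesis using lM by (simp add: irreducible_module_def)
qed

section \<open>Extension of scalars\<close>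

text \<open>Two formal sums have the same class exactly if their difference lies in the subgroup of
  relators, which reduces every claim below to a statement about relators.\<close>

locale scalar_extension = ring R for R :: "'a ring" (structure) +
  fixes S :: "'a set" and V :: "('a, 'v) module"
  assumes S_subset: "S \<subseteq> carrier R"
    and V_group: "abelian_group V"
    and V_smult: "\<And>s v. s \<in> S \<Longrightarrow> v \<in> carrier V \<Longrightarrow> s \<odot>\<^bsub>V\<^esub> v \<in> carrier V"
begin

sublocale V: abelian_group V by (rule V_group)

abbreviation "F \<equiv> tensor_free R V"
abbreviation "G \<equiv> tensor_sub R S V"
abbreviation "T \<equiv> tensor_module R S V"

definition cls :: "('a \<times> 'v \<Rightarrow>\<^sub>0 int) \<Rightarrow> ('a \<times> 'v \<Rightarrow>\<^sub>0 int) set" where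
  "cls c = G #>\<^bsub>F\<^esub> c"

definition act :: "'a \<Rightarrow> ('a \<times> 'v \<Rightarrow>\<^sub>0 int) \<Rightarrow> ('a \<times> 'v \<Rightarrow>\<^sub>0 int)" where
  "act r = frag_extend (\<lambda>(h, v). frag_of (r \<otimes> h, v))"

sublocale F: comm_group F
  unfolding tensor_free_def by (rule abelian_free_Abelian_group)

lemma F_carrier [simp]: "c \<in> carrier F \<longleftrightarrow> Poly_Mapping.keys c \<subseteq> carrier R \<times> carrier V"
  and F_mult [simp]: "b \<otimes>\<^bsub>F\<^esub> c = b + c"
  and F_one [simp]: "\<one>\<^bsub>F\<^esub> = 0"
  by (simp_all add: tensor_free_def)

lemma F_inv: "c \<in> carrier F \<Longrightarrow> inv\<^bsub>F\<^esub> c = - c"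
  by (simp add: tensor_free_def)

lemma F_add: "b \<in> carrier F \<Longrightarrow> c \<in> carrier F \<Longrightarrow> b + c \<in> carrier F"
  using F.m_closed by simp

lemma F_diff: "b \<in> carrier F \<Longrightarrow> c \<in> carrier F \<Longrightarrow> b - c \<in> carrier F"
  using keys_diff[of b c] by auto

lemma frag_in_F: "h \<in> carrier R \<Longrightarrow> v \<in> carrier V \<Longrightarrow> frag_of (h, v) \<in> carrier F"
  by simp

lemma relators_subset: "tensor_relators R S V \<subseteq> carrier F"
proof -
  have "frag_of (h, v) \<in> carrier F" if "h \<in> carrier R" "v \<in> carrier V" for h v
    using that by simp
  then show ?thesis
    unfolding tensor_relators_def using S_subset V_smult
    by (auto simp del: F_carrier keys_frag_of intro!: F_diff)
qed

sublocale G: subgroup G F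
  unfolding tensor_sub_def by (rule F.generate_is_subgroup[OF relators_subset])

sublocale G: normal G F
  using F.subgroup_imp_normal G.subgroup_axioms .

lemma relator_in_G: "c \<in> tensor_relators R S V \<Longrightarrow> c \<in> G"
  unfolding tensor_sub_def by (rule generate.incl)

lemma G_minus: "c \<in> G \<Longrightarrow> - c \<in> G"
  by (metis F_inv G.m_inv_closed G.mem_carrier)

lemma cls_eq_iff:
  assumes "b \<in> carrier F" "c \<in> carrier F"
  shows "cls b = cls c \<longleftrightarrow> b - c \<in> G"
proof -
  have set: "cls c = {g + c | g. g \<in> G}" for c by (auto simp: cls_def r_coset_def)
  show ?thesis
  proof
    assume "cls b = cls c"
    moreover have "b \<in> cls b" using G.one_closed by (force simp: set)
    ultimately show "b - c \<in> G" by (auto simp: set)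
  next
    assume bc: "b - c \<in> G"
    have "g + b \<in> cls c" if "g \<in> G" for g
      using G.m_closed[OF that bc] by (auto simp: set intro!: exI[of _ "g + (b - c)"])
    moreover have "g + c \<in> cls b" if "g \<in> G" for g
      using G.m_closed[OF that G_minus[OF bc]] by (auto simp: set intro!: exI[of _ "g + (c - b)"])
    ultimately show "cls b = cls c" by (auto simp: set)
  qed
qed

lemma cls_self: "c \<in> cls c"
  using G.one_closed by (force simp: cls_def r_coset_def)

lemma carrier_T: "carrier T = cls ` carrier F"
  by (auto simp: tensor_module_def FactGroup_def RCOSETS_def cls_def)

lemma T_zero: "\<zero>\<^bsub>T\<^esub> = cls 0"
  using G.subset F.coset_join2[of 0 G] G.subgroup_axioms G.one_closed
  by (simp add: tensor_module_def FactGroup_def cls_def)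

lemma T_add: "b \<in> carrier F \<Longrightarrow> c \<in> carrier F \<Longrightarrow> cls b \<oplus>\<^bsub>T\<^esub> cls c = cls (b + c)"
  using G.rcos_sum[of b c] by (simp add: tensor_module_def FactGroup_def cls_def)

lemma act_add: "act r (b + c) = act r b + act r c"
  and act_diff: "act r (b - c) = act r b - act r c"
  and act_0: "act r 0 = 0"
  and act_minus: "act r (- b) = - act r b"
  and act_frag: "act r (frag_of (h, v)) = frag_of (r \<otimes> h, v)"
  by (simp_all add: act_def frag_extend_add frag_extend_diff frag_extend_minus)

lemma F_induct [consumes 1, case_names zero diff frag]:
  assumes "c \<in> carrier F"
    and "P 0"
    and "\<And>b c. b \<in> carrier F \<Longrightarrow> c \<in> carrier F \<Longrightarrow> P b \<Longrightarrow> P c \<Longrightarrow> P (b - c)"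
    and "\<And>h v. h \<in> carrier R \<Longrightarrow> v \<in> carrier V \<Longrightarrow> P (frag_of (h, v))"
  shows "P c"
  using assms(1) unfolding F_carrier
  by (rule free_Abelian_group_induct) (use assms(2-) in auto)

lemma act_closed:
  assumes "r \<in> carrier R" "c \<in> carrier F"
  shows "act r c \<in> carrier F"
  using assms(2)
proof (induction c rule: F_induct)
  case (diff b c)
  then show ?case unfolding act_diff by (intro F_diff)
qed (use assms(1) in \<open>simp_all add: act_0 act_frag\<close>)

lemma relators_cases [consumes 1, case_names add_left add_right balance]:
  assumes "c \<in> tensor_relators R S V"
    and "\<And>h h' v. h \<in> carrier R \<Longrightarrow> h' \<in> carrier R \<Longrightarrow> v \<in> carrier V \<Longrightarrow>
      P (frag_of (h \<oplus> h', v) - frag_of (h, v) - frag_of (h', v))"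
    and "\<And>h v v'. h \<in> carrier R \<Longrightarrow> v \<in> carrier V \<Longrightarrow> v' \<in> carrier V \<Longrightarrow>
      P (frag_of (h, v \<oplus>\<^bsub>V\<^esub> v') - frag_of (h, v) - frag_of (h, v'))"
    and "\<And>h s v. h \<in> carrier R \<Longrightarrow> s \<in> S \<Longrightarrow> v \<in> carrier V \<Longrightarrow>
      P (frag_of (h \<otimes> s, v) - frag_of (h, s \<odot>\<^bsub>V\<^esub> v))"
  shows "P c"
  using assms(1) unfolding tensor_relators_def
  by (elim UnE CollectE exE conjE) (simp_all only: assms(2-4))

lemma relatorI:
  "h \<in> carrier R \<Longrightarrow> h' \<in> carrier R \<Longrightarrow> v \<in> carrier V \<Longrightarrow>
      frag_of (h \<oplus> h', v) - frag_of (h, v) - frag_of (h', v) \<in> tensor_relators R S V"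
  "h \<in> carrier R \<Longrightarrow> v \<in> carrier V \<Longrightarrow> v' \<in> carrier V \<Longrightarrow>
      frag_of (h, v \<oplus>\<^bsub>V\<^esub> v') - frag_of (h, v) - frag_of (h, v') \<in> tensor_relators R S V"
  "h \<in> carrier R \<Longrightarrow> s \<in> S \<Longrightarrow> v \<in> carrier V \<Longrightarrow>
      frag_of (h \<otimes> s, v) - frag_of (h, s \<odot>\<^bsub>V\<^esub> v) \<in> tensor_relators R S V"
  unfolding tensor_relators_def by blast+

lemma act_relator:
  assumes r: "r \<in> carrier R" and c: "c \<in> tensor_relators R S V"
  shows "act r c \<in> tensor_relators R S V"
  using c
proof (induction rule: relators_cases)
  case (add_left h h' v)
  then show ?case using relatorI(1)[of "r \<otimes> h" "r \<otimes> h'" v] r by (simp add: act_diff act_frag r_distr)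
next
  case (add_right h v v')
  then show ?case using relatorI(2)[of "r \<otimes> h" v v'] r by (simp add: act_diff act_frag)
next
  case (balance h s v)
  then show ?case
    using relatorI(3)[of "r \<otimes> h" s v] r S_subset by (simp add: act_diff act_frag m_assoc subset_iff)
qed

lemma act_G:
  assumes r: "r \<in> carrier R" and c: "c \<in> G"
  shows "act r c \<in> G"
  using c unfolding tensor_sub_def
proof (induction rule: generate.induct)
  case one
  show ?case by (simp add: act_0 generate.one[of F, simplified])
next
  case (incl c)
  then show ?case using act_relator[OF r] by (blast intro: generate.incl)
next
  case (inv c)
  then have "act r (inv\<^bsub>F\<^esub> c) = - act r c"
    using relators_subset F_inv[of c] by (auto simp: act_minus)
  also have "\<dots> \<in> G" using act_relator[OF r inv] by (blast intro: G_minus relator_in_G)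
  finally show ?case by (simp add: tensor_sub_def)
next
  case (eng b c)
  then show ?case by (metis F_mult act_add generate.eng)
qed

lemma T_smult:
  assumes r: "r \<in> carrier R" and c: "c \<in> carrier F"
  shows "r \<odot>\<^bsub>T\<^esub> cls c = cls (act r c)"
proof -
  have "cls (act r b) = cls (act r c)" if b: "b \<in> cls c" for b
  proof -
    obtain g where g: "g \<in> G" "b = g + c" using b unfolding cls_def r_coset_def by auto
    have "act r b - act r c = act r g" by (simp add: g act_add)
    then show ?thesis
      using act_G[OF r g(1)] g c G.mem_carrier[OF g(1)]
      by (subst cls_eq_iff) (auto intro!: act_closed r F_add simp del: F_carrier)
  qed
  then have "(\<Union>b\<in>cls c. cls (act r b)) = cls (act r c)" using cls_self by fast
  then show ?thesis by (simp add: tensor_module_def cls_def act_def)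
qed

lemma T_carrierE:
  assumes "x \<in> carrier T" obtains c where "c \<in> carrier F" "x = cls c"
  using assms by (auto simp: carrier_T)

lemma cls_in_T: "c \<in> carrier F \<Longrightarrow> cls c \<in> carrier T"
  by (auto simp: carrier_T)

lemma act_l_distr:
  assumes r: "r \<in> carrier R" "r' \<in> carrier R" and c: "c \<in> carrier F"
  shows "act (r \<oplus> r') c - (act r c + act r' c) \<in> G"
  using c
proof (induction c rule: F_induct)
  case zero
  then show ?case using G.one_closed by (simp add: act_0)
next
  case (diff b c)
  have "act (r \<oplus> r') (b - c) - (act r (b - c) + act r' (b - c))
    = (act (r \<oplus> r') b - (act r b + act r' b)) + - (act (r \<oplus> r') c - (act r c + act r' c))"
    by (simp add: act_diff)
  also have "\<dots> \<in> G" using G.m_closed[OF diff.IH(1) G_minus[OF diff.IH(2)]] by simp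
  finally show ?case .
next
  case (frag h v)
  then show ?case
    using relator_in_G[OF relatorI(1), of "r \<otimes> h" "r' \<otimes> h" v] r by (simp add: act_frag l_distr diff_diff_eq)
qed

lemma act_assoc:
  assumes r: "r \<in> carrier R" "r' \<in> carrier R" and c: "c \<in> carrier F"
  shows "act (r \<otimes> r') c = act r (act r' c)"
  using c by (induction c rule: F_induct) (use r in \<open>auto simp: act_0 act_diff act_frag m_assoc\<close>)

lemma act_one: "c \<in> carrier F \<Longrightarrow> act \<one> c = c"
  by (induction c rule: F_induct) (auto simp: act_0 act_diff act_frag)

lemma T_abelian_group: "abelian_group T"
proof (rule abelian_groupI)
  fix x y z assume "x \<in> carrier T" "y \<in> carrier T" "z \<in> carrier T"
  then obtain a b c where abc: "a \<in> carrier F" "x = cls a" "b \<in> carrier F" "y = cls b"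
      "c \<in> carrier F" "z = cls c"
    by (auto elim!: T_carrierE simp del: F_carrier)
  show "x \<oplus>\<^bsub>T\<^esub> y \<in> carrier T" "x \<oplus>\<^bsub>T\<^esub> y = y \<oplus>\<^bsub>T\<^esub> x" "x \<oplus>\<^bsub>T\<^esub> y \<oplus>\<^bsub>T\<^esub> z = x \<oplus>\<^bsub>T\<^esub> (y \<oplus>\<^bsub>T\<^esub> z)"
    using abc by (simp_all add: T_add F_add cls_in_T ac_simps del: F_carrier)
next
  fix x assume "x \<in> carrier T"
  then obtain a where a: "a \<in> carrier F" "x = cls a" by (rule T_carrierE)
  have 0: "0 \<in> carrier F" and m: "- a \<in> carrier F" using a by simp_all
  show "\<zero>\<^bsub>T\<^esub> \<oplus>\<^bsub>T\<^esub> x = x" using a by (simp add: T_zero T_add[OF 0] del: F_carrier)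
  show "\<exists>y\<in>carrier T. y \<oplus>\<^bsub>T\<^esub> x = \<zero>\<^bsub>T\<^esub>"
    using T_add[OF m a(1)] cls_in_T[OF m] a by (auto simp: T_zero)
qed (auto simp: T_zero intro: cls_in_T)

lemma T_left_module: "left_module R T"
proof (intro left_module.intro left_module_axioms.intro T_abelian_group ring_axioms)
  fix r r' x y assume r: "r \<in> carrier R" "r' \<in> carrier R" and "x \<in> carrier T" "y \<in> carrier T"
  then obtain b c where bc: "b \<in> carrier F" "x = cls b" "c \<in> carrier F" "y = cls c"
    by (auto elim!: T_carrierE simp del: F_carrier)
  show "r \<odot>\<^bsub>T\<^esub> x \<in> carrier T"
    using bc r by (simp add: T_smult act_closed cls_in_T del: F_carrier)
  show "r \<odot>\<^bsub>T\<^esub> (x \<oplus>\<^bsub>T\<^esub> y) = r \<odot>\<^bsub>T\<^esub> x \<oplus>\<^bsub>T\<^esub> r \<odot>\<^bsub>T\<^esub> y"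
    using bc r by (simp add: T_smult T_add act_closed F_add act_add del: F_carrier)
  show "(r \<otimes> r') \<odot>\<^bsub>T\<^esub> x = r \<odot>\<^bsub>T\<^esub> (r' \<odot>\<^bsub>T\<^esub> x)"
    using bc r by (simp add: T_smult act_closed act_assoc del: F_carrier)
  show "(r \<oplus> r') \<odot>\<^bsub>T\<^esub> x = r \<odot>\<^bsub>T\<^esub> x \<oplus>\<^bsub>T\<^esub> r' \<odot>\<^bsub>T\<^esub> x"
    using bc r act_l_distr[of r r' b]
    by (simp add: T_smult T_add act_closed F_add cls_eq_iff del: F_carrier)
next
  fix x assume "x \<in> carrier T"
  then show "\<one> \<odot>\<^bsub>T\<^esub> x = x" by (auto elim!: T_carrierE simp: T_smult act_one simp del: F_carrier)
qed

sublocale T: left_module R T by (rule T_left_module)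

lemma pure_cls: "pure_tensor R S V h v = cls (frag_of (h, v))"
  by (simp add: pure_tensor_def cls_def)

lemma pure_closed: "h \<in> carrier R \<Longrightarrow> v \<in> carrier V \<Longrightarrow> pure_tensor R S V h v \<in> carrier T"
  by (simp add: pure_cls cls_in_T)

lemma smult_pure:
  "r \<in> carrier R \<Longrightarrow> h \<in> carrier R \<Longrightarrow> v \<in> carrier V \<Longrightarrow>
    r \<odot>\<^bsub>T\<^esub> pure_tensor R S V h v = pure_tensor R S V (r \<otimes> h) v"
  by (simp add: pure_cls T_smult act_frag)

lemma pure_balanced:
  assumes "h \<in> carrier R" "s \<in> S" "v \<in> carrier V"
  shows "pure_tensor R S V (h \<otimes> s) v = pure_tensor R S V h (s \<odot>\<^bsub>V\<^esub> v)"
  using assms S_subset V_smult relator_in_G[OF relatorI(3)[OF assms]]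
  by (simp add: pure_cls cls_eq_iff subset_iff)

lemma T_induct [consumes 1, case_names zero diff pure]:
  assumes "x \<in> carrier T"
    and zero: "P \<zero>\<^bsub>T\<^esub>"
    and diff: "\<And>x y. x \<in> carrier T \<Longrightarrow> y \<in> carrier T \<Longrightarrow> P x \<Longrightarrow> P y \<Longrightarrow> P (x \<ominus>\<^bsub>T\<^esub> y)"
    and pure: "\<And>h v. h \<in> carrier R \<Longrightarrow> v \<in> carrier V \<Longrightarrow> P (pure_tensor R S V h v)"
  shows "P x"
proof -
  obtain c where c: "c \<in> carrier F" "x = cls c" using assms(1) by (rule T_carrierE)
  have "P (cls c)" using c(1)
  proof (induction c rule: F_induct)
    case zero
    then show ?case using assms(2) by (simp add: T_zero)
  next
    case (diff b c)
    have "cls (b - c) \<oplus>\<^bsub>T\<^esub> cls c = cls b" using diff by (simp add: T_add F_diff del: F_carrier)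
    then have "cls (b - c) = cls b \<ominus>\<^bsub>T\<^esub> cls c"
      using diff.hyps cls_in_T F_diff
      by (metis T.M.add.inv_solve_right' a_minus_def)
    then show ?case using assms(3) diff cls_in_T by simp
  next
    case (frag h v)
    then show ?case using assms(4) by (simp add: pure_cls)
  qed
  then show ?thesis by (simp add: c)
qed

text \<open>The universal property of extension of scalars: a map \<open>V \<rightarrow> L\<close> that is additive and compatible
  with \<open>S\<close> extends to the free abelian group by \<open>h \<otimes> v \<mapsto> h (f v)\<close>, and the extension kills the
  relators.\<close>

lemma T_universal:
  assumes L: "left_module R L"
    and f: "\<And>v. v \<in> carrier V \<Longrightarrow> f v \<in> carrier L"
    and f_add: "\<And>v w. v \<in> carrier V \<Longrightarrow> w \<in> carrier V \<Longrightarrow> f (v \<oplus>\<^bsub>V\<^esub> w) = f v \<oplus>\<^bsub>L\<^esub> f w"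
    and f_smult: "\<And>s v. s \<in> S \<Longrightarrow> v \<in> carrier V \<Longrightarrow> f (s \<odot>\<^bsub>V\<^esub> v) = s \<odot>\<^bsub>L\<^esub> f v"
  obtains g where "g \<in> left_module_hom R T L"
    "\<And>h v. h \<in> carrier R \<Longrightarrow> v \<in> carrier V \<Longrightarrow> g (pure_tensor R S V h v) = h \<odot>\<^bsub>L\<^esub> f v"
proof -
  interpret L: left_module R L by fact
  have "(\<lambda>(h, v). h \<odot>\<^bsub>L\<^esub> f v) ` (carrier R \<times> carrier V) \<subseteq> carrier (add_monoid L)"
    by (auto simp: L.lm_smult_closed f)
  then obtain k where k: "k \<in> hom (free_Abelian_group (carrier R \<times> carrier V)) (add_monoid L)"
    and k_frag': "\<And>x. x \<in> carrier R \<times> carrier V \<Longrightarrow> k (frag_of x) = (\<lambda>(h, v). h \<odot>\<^bsub>L\<^esub> f v) x"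
    by (rule comm_group.free_Abelian_group_universal[OF L.M.a_comm_group]) blast
  have k: "k \<in> hom F (add_monoid L)" using k by (simp add: tensor_free_def)
  interpret k: group_hom F "add_monoid L" k
    by (simp add: group_hom_def group_hom_axioms_def k)
  have k_frag: "k (frag_of (h, v)) = h \<odot>\<^bsub>L\<^esub> f v" if "h \<in> carrier R" "v \<in> carrier V" for h v
    using that k_frag' by simp
  have k_closed: "k c \<in> carrier L" if "c \<in> carrier F" for c using k.hom_closed[OF that] by simp
  have k_add: "k (b + c) = k b \<oplus>\<^bsub>L\<^esub> k c" if "b \<in> carrier F" "c \<in> carrier F" for b c
    using k.hom_mult[OF that] by simp
  have k_0: "k 0 = \<zero>\<^bsub>L\<^esub>" using k.hom_one by simp
  have k_minus: "k (- c) = \<ominus>\<^bsub>L\<^esub> k c" if "c \<in> carrier F" for c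
    using k.hom_inv[OF that] F_inv[OF that] by (simp add: a_inv_def)
  have k_diff: "k (b - c) = k b \<ominus>\<^bsub>L\<^esub> k c" if "b \<in> carrier F" "c \<in> carrier F" for b c
    using k_add[of b "- c"] k_minus[of c] that by (simp add: a_minus_def)
  have diff0: "x \<oplus>\<^bsub>L\<^esub> y \<ominus>\<^bsub>L\<^esub> x \<ominus>\<^bsub>L\<^esub> y = \<zero>\<^bsub>L\<^esub>" if "x \<in> carrier L" "y \<in> carrier L" for x y
    using that L.M.r_neg[of "x \<oplus>\<^bsub>L\<^esub> y"] by (simp add: a_minus_def L.M.minus_add L.M.a_assoc)
  have k_rel: "k c = \<zero>\<^bsub>L\<^esub>" if c: "c \<in> tensor_relators R S V" for c
    using c
  proof (induction rule: relators_cases)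
    case (add_left h h' v)
    then show ?case
      by (simp add: k_diff F_diff frag_in_F k_frag L.lm_smult_l_distr f diff0 L.lm_smult_closed del: F_carrier)
  next
    case (add_right h v v')
    then show ?case
      by (simp add: k_diff F_diff frag_in_F k_frag L.lm_smult_r_distr f f_add diff0 L.lm_smult_closed del: F_carrier)
  next
    case (balance h s v)
    then have "s \<in> carrier R" using S_subset by blast
    with balance show ?case
      by (simp add: k_diff F_diff frag_in_F k_frag L.lm_smult_assoc f f_smult V_smult L.lm_smult_closed
            L.M.r_neg a_minus_def del: F_carrier)
  qed
  have k_G: "k c = \<zero>\<^bsub>L\<^esub>" if "c \<in> G" for c
    using that unfolding tensor_sub_def
  proof (induction rule: generate.induct)
    case one then show ?case by (simp add: k_0)
  next
    case (incl c) then show ?case by (rule k_rel)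
  next
    case (inv c)
    moreover from inv have "c \<in> carrier F" using relators_subset by blast
    ultimately show ?case using k_minus k_rel F_inv by simp
  next
    case (eng b c)
    moreover from eng have "b \<in> carrier F" "c \<in> carrier F" using G.mem_carrier by (auto simp: tensor_sub_def)
    ultimately show ?case using k_add by simp
  qed
  have act: "k (act r c) = r \<odot>\<^bsub>L\<^esub> k c" if r: "r \<in> carrier R" and c: "c \<in> carrier F" for r c
    using c
  proof (induction c rule: F_induct)
    case zero then show ?case using r by (simp add: act_0 k_0)
  next
    case (diff b c)
    then show ?case
      using r by (simp add: act_diff k_diff act_closed a_minus_def L.lm_smult_r_distr L.smult_r_minus k_closed del: F_carrier)
  next
    case (frag h v)
    then show ?case using r by (simp add: act_frag k_frag L.lm_smult_assoc f)
  qed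
  define g where "g x = k (SOME c. c \<in> carrier F \<and> cls c = x)" for x
  have g_cls: "g (cls c) = k c" if c: "c \<in> carrier F" for c
  proof -
    define b where "b = (SOME b. b \<in> carrier F \<and> cls b = cls c)"
    have "b \<in> carrier F \<and> cls b = cls c" unfolding b_def by (rule someI[of _ c]) (use c in simp)
    then have b: "b \<in> carrier F" "cls b = cls c" by blast+
    then have "k (b - c) = \<zero>\<^bsub>L\<^esub>" using cls_eq_iff[of b c] c k_G by blast
    moreover have "k b = k (b - c) \<oplus>\<^bsub>L\<^esub> k c" using k_add[of "b - c" c] b c F_diff by simp
    ultimately have "k b = k c" using k_closed[OF c] by simp
    then show ?thesis by (simp add: g_def b_def)
  qed
  have "g \<in> left_module_hom R T L"
  proof (rule left_module_homI)
    fix x y assume "x \<in> carrier T" "y \<in> carrier T"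
    then obtain b c where bc: "b \<in> carrier F" "x = cls b" "c \<in> carrier F" "y = cls c"
      by (auto elim!: T_carrierE simp del: F_carrier)
    show "g x \<in> carrier L" using bc by (simp add: g_cls k_closed del: F_carrier)
    show "g (x \<oplus>\<^bsub>T\<^esub> y) = g x \<oplus>\<^bsub>L\<^esub> g y"
      using bc by (simp add: T_add g_cls k_add F_add del: F_carrier)
    show "g (r \<odot>\<^bsub>T\<^esub> x) = r \<odot>\<^bsub>L\<^esub> g x" if "r \<in> carrier R" for r
      using bc that by (simp add: T_smult g_cls act act_closed del: F_carrier)
  qed
  moreover have "g (pure_tensor R S V h v) = h \<odot>\<^bsub>L\<^esub> f v" if "h \<in> carrier R" "v \<in> carrier V" for h v
    using that by (simp add: pure_cls g_cls k_frag)
  ultimately show thesis by (rule that)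
qed

end

section \<open>Computing in the affine Hecke algebra\<close>

lemma poly_mapping_single_induct [case_names zero add]:
  fixes f :: "'a \<Rightarrow>\<^sub>0 'b::comm_monoid_add"
  assumes "P 0" and "\<And>f k c. P f \<Longrightarrow> P (f + Poly_Mapping.single k c)"
  shows "P f"
proof (induction f rule: update_induct)
  case (update f k c)
  have "Poly_Mapping.update k c f = f + Poly_Mapping.single k c"
    using update(1) by (intro poly_mapping_eqI) (auto simp: lookup_update lookup_add lookup_single in_keys_iff when_def)
  then show ?case using assms(2) update by metis
qed (rule assms(1))

lemma ring_of_type_algebra_simps [simp]:
  "carrier (ring_of_type_algebra :: 'a::ring_1 ring) = UNIV"
  "a \<oplus>\<^bsub>(ring_of_type_algebra :: 'a::ring_1 ring)\<^esub> b = a + b"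
  "a \<otimes>\<^bsub>(ring_of_type_algebra :: 'a::ring_1 ring)\<^esub> b = a * b"
  "\<zero>\<^bsub>(ring_of_type_algebra :: 'a::ring_1 ring)\<^esub> = 0"
  "\<one>\<^bsub>(ring_of_type_algebra :: 'a::ring_1 ring)\<^esub> = 1"
  by (simp_all add: ring_of_type_algebra_def)

lemma ring_free_ring: "ring free_ring"
proof (rule ringI)
  show "abelian_group free_ring"
  proof (rule abelian_groupI)
    show "\<exists>b\<in>carrier free_ring. b \<oplus>\<^bsub>free_ring\<^esub> a = \<zero>\<^bsub>free_ring\<^esub>" for a
      by (rule bexI[of _ "- a"]) simp_all
  qed (simp_all add: ac_simps)
  show "monoid free_ring"
    by (rule monoidI) (simp_all add: mult.assoc)
qed (simp_all add: algebra_simps)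

lemma ideal_hecke_ideal: "ideal (hecke_ideal q) free_ring"
  unfolding hecke_ideal_def by (rule ring.genideal_ideal[OF ring_free_ring]) simp

lemma relators_in_hecke_ideal: "hecke_relators q \<subseteq> hecke_ideal q"
  unfolding hecke_ideal_def by (rule ring.genideal_self[OF ring_free_ring]) simp

lemma ring_hecke: "ring (hecke q)"
  unfolding hecke_def by (rule ideal.quotient_is_ring[OF ideal_hecke_ideal])

interpretation hecke: ring "hecke q" for q by (rule ring_hecke)

lemma hecke_cls_closed [simp]: "hecke_cls q a \<in> carrier (hecke q)"
  and hecke_cls_add: "hecke_cls q (a + b) = hecke_cls q a \<oplus>\<^bsub>hecke q\<^esub> hecke_cls q b"
  and hecke_cls_mult: "hecke_cls q (a * b) = hecke_cls q a \<otimes>\<^bsub>hecke q\<^esub> hecke_cls q b"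
  and hecke_cls_one: "hecke_cls q 1 = \<one>\<^bsub>hecke q\<^esub>"
  using ideal.rcos_ring_hom[OF ideal_hecke_ideal[of q]]
  by (auto simp: ring_hom_def hecke_def hecke_cls_def)

lemma hecke_cls_zero: "hecke_cls q 0 = \<zero>\<^bsub>hecke q\<^esub>"
  using hecke_cls_add[of q 0 0] by (simp add: hecke.add.r_cancel_one')

lemma hecke_carrierE:
  assumes "h \<in> carrier (hecke q)" obtains a where "h = hecke_cls q a"
  using assms by (auto simp: hecke_def FactRing_def A_RCOSETS_def RCOSETS_def hecke_cls_def a_r_coset_def)

lemma hecke_cls_eq_iff: "hecke_cls q a = hecke_cls q b \<longleftrightarrow> a - b \<in> hecke_ideal q"
proof -
  interpret ideal "hecke_ideal q" free_ring by (rule ideal_hecke_ideal)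
  have "\<ominus>\<^bsub>free_ring\<^esub> b = - b"
    using abelian_group.minus_equality[OF is_abelian_group, of "- b" b] by simp
  then have "a \<ominus>\<^bsub>free_ring\<^esub> b = a - b" by (simp add: a_minus_def)
  then show ?thesis
    using quotient_eq_iff_same_a_r_cos[OF ideal_axioms, of a b] by (simp add: hecke_cls_def)
qed

lemma hecke_cls_relator:
  "a - b \<in> hecke_relators q \<Longrightarrow> hecke_cls q a = hecke_cls q b"
  using relators_in_hecke_ideal by (auto simp: hecke_cls_eq_iff)

lemma hscal_closed [simp]: "hscal q c \<in> carrier (hecke q)"
  and hT_closed [simp]: "hT q i \<in> carrier (hecke q)"
  and hX_closed [simp]: "hX q l \<in> carrier (hecke q)"
  by (simp_all add: hscal_def hT_def hX_def)

lemma free_scal_add: "free_scal (a + b) = free_scal a + free_scal b"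
  by (simp add: free_scal_def single_add)

lemma free_scal_mult: "free_scal (a * b) = free_scal a * free_scal b"
  by (simp add: free_scal_def mult_single plus_list_def)

lemma free_scal_one: "free_scal 1 = 1"
  by (simp add: free_scal_def flip: zero_list_def)

lemma free_scal_commute: "free_scal c * a = a * free_scal c"
  by (induction a rule: poly_mapping_single_induct)
    (simp_all add: distrib_left distrib_right free_scal_def mult_single plus_list_def mult.commute)

lemma hscal_add: "hscal q (a + b) = hscal q a \<oplus>\<^bsub>hecke q\<^esub> hscal q b"
  and hscal_mult: "hscal q (a * b) = hscal q a \<otimes>\<^bsub>hecke q\<^esub> hscal q b"
  and hscal_one: "hscal q 1 = \<one>\<^bsub>hecke q\<^esub>"
  by (simp_all add: hscal_def free_scal_add free_scal_mult free_scal_one hecke_cls_add hecke_cls_mult hecke_cls_one)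

lemma hscal_zero: "hscal q 0 = \<zero>\<^bsub>hecke q\<^esub>"
  by (simp add: hscal_def free_scal_def hecke_cls_zero)

lemma hscal_minus: "hscal q (- a) = \<ominus>\<^bsub>hecke q\<^esub> hscal q a"
  using hscal_add[of q "- a" a] by (intro hecke.minus_equality[symmetric]) (simp_all add: hscal_zero)

lemma hscal_central:
  assumes "h \<in> carrier (hecke q)"
  shows "hscal q c \<otimes>\<^bsub>hecke q\<^esub> h = h \<otimes>\<^bsub>hecke q\<^esub> hscal q c"
proof -
  obtain a where "h = hecke_cls q a" using assms by (rule hecke_carrierE)
  then show ?thesis by (simp add: hscal_def free_scal_commute flip: hecke_cls_mult)
qed

lemma hX_zero: "hX q 0 = \<one>\<^bsub>hecke q\<^esub>"
  unfolding hX_def hecke_cls_one[symmetric] by (rule hecke_cls_relator) (simp add: hecke_relators_def)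

lemma hX_mult: "hX q l \<otimes>\<^bsub>hecke q\<^esub> hX q m = hX q (l + m)"
  unfolding hX_def hecke_cls_mult[symmetric]
  by (rule hecke_cls_relator) (unfold hecke_relators_def, blast)

lemma hT_square:
  "hT q i \<otimes>\<^bsub>hecke q\<^esub> hT q i = hscal q (q - inverse q) \<otimes>\<^bsub>hecke q\<^esub> hT q i \<oplus>\<^bsub>hecke q\<^esub> \<one>\<^bsub>hecke q\<^esub>"
  unfolding hT_def hscal_def hecke_cls_mult[symmetric] hecke_cls_add[symmetric] hecke_cls_one[symmetric]
  by (rule hecke_cls_relator) (unfold hecke_relators_def, blast)

lemma hT_braid:
  "hT q Node1 \<otimes>\<^bsub>hecke q\<^esub> hT q Node2 \<otimes>\<^bsub>hecke q\<^esub> hT q Node1 \<otimes>\<^bsub>hecke q\<^esub> hT q Node2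
    = hT q Node2 \<otimes>\<^bsub>hecke q\<^esub> hT q Node1 \<otimes>\<^bsub>hecke q\<^esub> hT q Node2 \<otimes>\<^bsub>hecke q\<^esub> hT q Node1"
  unfolding hT_def hecke_cls_mult[symmetric]
  by (rule hecke_cls_relator) (unfold hecke_relators_def, blast)

lemma free_ga_single: "free_ga (ga_X l) = free_X l"
  by (simp add: free_ga_def free_scal_one)

lemma free_ga_zero: "free_ga 0 = 0"
  by (simp add: free_ga_def)

text \<open>The Bernstein relation in the two cases in which the quotient of the group algebra is a
  single term or zero. As every weight is a combination of fundamental weights, these determine
  the action of all \<open>X\<^sup>\<lambda>\<close> on words in the \<open>T\<^sub>i\<close>.\<close>

lemma hX_hT_pairing_one:
  assumes "coroot_pairing l i = 1"
  shows "hX q l \<otimes>\<^bsub>hecke q\<^esub> hT q i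
    = hT q i \<otimes>\<^bsub>hecke q\<^esub> hX q (srefl i l) \<oplus>\<^bsub>hecke q\<^esub> hscal q (q - inverse q) \<otimes>\<^bsub>hecke q\<^esub> hX q l"
proof -
  have "is_dem_quot i l (ga_X l)"
    using geometric_ga[where n = 1 and l = l and a = "sroot i"] assms
    by (simp add: is_dem_quot_def srefl_def wscale_def flip: zero_prod_def)
  then have "free_X l * free_T i - (free_T i * free_X (srefl i l) + free_scal (q - inverse q) * free_ga (ga_X l))
      \<in> hecke_relators q"
    unfolding hecke_relators_def by blast
  then show ?thesis
    unfolding hT_def hX_def hscal_def hecke_cls_mult[symmetric] hecke_cls_add[symmetric] free_ga_single
    by (rule hecke_cls_relator)
qed

lemma hX_hT_pairing_zero:
  assumes "coroot_pairing l i = 0"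
  shows "hX q l \<otimes>\<^bsub>hecke q\<^esub> hT q i = hT q i \<otimes>\<^bsub>hecke q\<^esub> hX q l"
proof -
  have refl: "srefl i l = l"
    using assms by (simp add: srefl_def wscale_def flip: zero_prod_def)
  then have "is_dem_quot i l 0" by (simp add: is_dem_quot_def)
  then have "free_X l * free_T i - (free_T i * free_X (srefl i l) + free_scal (q - inverse q) * free_ga 0)
      \<in> hecke_relators q"
    unfolding hecke_relators_def by blast
  then have "free_X l * free_T i - free_T i * free_X l \<in> hecke_relators q"
    by (simp add: refl free_ga_zero)
  then show ?thesis
    unfolding hT_def hX_def hecke_cls_mult[symmetric] by (rule hecke_cls_relator)
qed

text \<open>The generators generate: an element of the algebra is the class of a linear combination of
  words. Compatibility of a map with the whole algebra is thereby reduced to the generators.\<close>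

lemma hecke_induct [consumes 1, case_names scal T X add mult]:
  assumes "h \<in> carrier (hecke q)"
    and scal: "\<And>c. P (hscal q c)" and T: "\<And>i. P (hT q i)" and X: "\<And>l. P (hX q l)"
    and add: "\<And>g h. g \<in> carrier (hecke q) \<Longrightarrow> h \<in> carrier (hecke q) \<Longrightarrow> P g \<Longrightarrow> P h \<Longrightarrow> P (g \<oplus>\<^bsub>hecke q\<^esub> h)"
    and mult: "\<And>g h. g \<in> carrier (hecke q) \<Longrightarrow> h \<in> carrier (hecke q) \<Longrightarrow> P g \<Longrightarrow> P h \<Longrightarrow> P (g \<otimes>\<^bsub>hecke q\<^esub> h)"
  shows "P h"
proof -
  have gen: "P (hecke_cls q (Poly_Mapping.single [g] 1))" for g
    using T X by (cases g) (simp_all add: hT_def hX_def free_T_def free_X_def)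
  have word: "P (hecke_cls q (Poly_Mapping.single w c))" for w c
  proof (induction w)
    case Nil
    then show ?case using scal[of c] by (simp add: hscal_def free_scal_def)
  next
    case (Cons g w)
    have "Poly_Mapping.single (g # w) c = Poly_Mapping.single [g] 1 * Poly_Mapping.single w c"
      by (simp add: mult_single plus_list_def)
    then show ?case using mult[OF _ _ gen Cons] by (simp add: hecke_cls_mult)
  qed
  have "P (hecke_cls q a)" for a
  proof (induction a rule: poly_mapping_single_induct)
    case zero
    then show ?case using scal[of 0] by (simp add: hscal_def free_scal_def)
  next
    case (add f k c)
    then show ?case using assms(5)[OF _ _ add word] by (simp add: hecke_cls_add)
  qed
  then show ?thesis using assms(1) by (auto elim: hecke_carrierE)
qed

lemma int_pair_induct [case_names zero omega1 omega2 add minus]: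
  fixes l :: wt
  assumes zero: "P 0" and o1: "P (1, 0)" and o2: "P (0, 1)"
    and add: "\<And>l m. P l \<Longrightarrow> P m \<Longrightarrow> P (l + m)" and minus: "\<And>l. P l \<Longrightarrow> P (- l)"
  shows "P l"
proof -
  have "P (a, 0)" for a :: int
  proof (induction a rule: int_induct[where k = 0])
    case base then show ?case using zero by (simp add: zero_prod_def)
  next
    case (step1 i) then show ?case using add[OF _ o1, of "(i, 0)"] by simp
  next
    case (step2 i) then show ?case using add[OF _ minus[OF o1], of "(i, 0)"] by simp
  qed
  moreover have "P (0, b)" for b :: int
  proof (induction b rule: int_induct[where k = 0])
    case base then show ?case using zero by (simp add: zero_prod_def)
  next
    case (step1 i) then show ?case using add[OF _ o2, of "(0, i)"] by simp
  next
    case (step2 i) then show ?case using add[OF _ minus[OF o2], of "(0, i)"] by simp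
  qed
  ultimately show ?thesis using add[of "(fst l, 0)" "(0, snd l)"] by simp
qed

section \<open>Weights whose orbit has two elements\<close>

lemma srefl_add: "srefl i (l + m) = srefl i l + srefl i m"
  by (cases i; cases l; cases m) (simp_all add: srefl_def wscale_def algebra_simps)

lemma srefl_minus: "srefl i (- l) = - srefl i l"
  by (cases i; cases l) (simp_all add: srefl_def wscale_def algebra_simps)

lemma srefl_zero: "srefl i 0 = 0"
  by (cases i) (simp_all add: srefl_def wscale_def zero_prod_def)

text \<open>The hypothesis on \<open>\<chi>\<close> is that \<open>\<chi>\<close> restricts to \<open>t\<^bsub>q\<^sup>2,1\<^esub>\<close> on the root lattice. It is inherited by
  \<open>s\<^sub>1\<chi>\<close>, so everything proved in this locale applies to both elements of the orbit.\<close>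

locale special_weight =
  fixes q :: complex and \<chi> :: "wt \<Rightarrow> complex"
  assumes q: "q\<^sup>2 = -1" and torus: "\<chi> \<in> torus"
    and root1: "\<chi> (sroot Node1) = -1" and root2: "\<chi> (sroot Node2) = 1"
begin

lemma q_q: "q * q = -1" "q * (q * z) = - z"
  using q by (simp_all add: power2_eq_square flip: mult.assoc)

lemma q_nonzero: "q \<noteq> 0" using q by auto

lemma inverse_q: "inverse q = - q"
  using q_q(1) q_nonzero by (simp add: field_simps)

lemma chi_add: "\<chi> (l + m) = \<chi> l * \<chi> m" and chi_nonzero: "\<chi> l \<noteq> 0"
  using torus by (auto simp: torus_def simp del: split_paired_All)

lemma chi_zero: "\<chi> 0 = 1"
  using chi_add[of 0 0] chi_nonzero[of 0] by simp

lemma chi_minus: "\<chi> (- l) = inverse (\<chi> l)"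
  using chi_add[of l "- l"] chi_zero chi_nonzero[of l] by (simp add: field_simps)

lemma chi_diff: "\<chi> (l - m) = \<chi> l / \<chi> m"
  using chi_add[of l "- m"] by (simp add: chi_minus divide_inverse)

lemma chi_omega2: "\<chi> (0, 1) = -1"
  using chi_add[of "sroot Node1" "sroot Node2"] root1 root2 by simp

lemma chi_omega1_square: "\<chi> (1, 0) * \<chi> (1, 0) = 1"
proof -
  have "\<chi> (1, 0) * \<chi> (1, 0) = \<chi> (sroot Node1 + (sroot Node1 + sroot Node2))"
    by (subst chi_add[symmetric]) simp
  then show ?thesis by (simp only: chi_add root1 root2) simp
qed

lemma reflected: "special_weight q (\<chi> \<circ> srefl Node1)"
proof
  have e: "srefl Node1 (sroot Node1) = - sroot Node1"
    "srefl Node1 (sroot Node2) = sroot Node1 + (sroot Node1 + sroot Node2)"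
    by (simp_all add: srefl_def wscale_def)
  show "(\<chi> \<circ> srefl Node1) (sroot Node1) = -1" "(\<chi> \<circ> srefl Node1) (sroot Node2) = 1"
    by (simp_all only: comp_def e chi_minus chi_add root1 root2) simp_all
  show "\<chi> \<circ> srefl Node1 \<in> torus"
    by (simp add: torus_def srefl_add chi_add chi_nonzero del: split_paired_All)
qed (rule q)

lemma chi_srefl2: "\<chi> (srefl Node2 l) = \<chi> l"
proof (induction l rule: int_pair_induct)
  case omega2
  have "srefl Node2 (0, 1) = (0, 1) - sroot Node2" by (simp add: srefl_def wscale_def)
  then show ?case by (simp only: chi_diff root2) simp
next
  case omega1
  then show ?case by (simp add: srefl_def wscale_def)
qed (simp_all only: srefl_zero srefl_add srefl_minus chi_add chi_minus)

lemma chi_s1_omega1: "\<chi> (srefl Node1 (1, 0)) = - \<chi> (1, 0)"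
  and chi_s1_omega2: "\<chi> (srefl Node1 (0, 1)) = -1"
proof -
  have "srefl Node1 (1, 0) = (1, 0) - sroot Node1" by (simp add: srefl_def wscale_def)
  then show "\<chi> (srefl Node1 (1, 0)) = - \<chi> (1, 0)" by (simp only: chi_diff root1) simp
  show "\<chi> (srefl Node1 (0, 1)) = -1" by (simp add: srefl_def wscale_def chi_omega2)
qed

lemma chi_reflected_srefl2: "\<chi> (srefl Node1 (srefl Node2 l)) = \<chi> (srefl Node1 l)"
  using special_weight.chi_srefl2[OF reflected] by simp

end

section \<open>The four-dimensional model\<close>

type_synonym vec4 = "complex \<times> complex \<times> complex \<times> complex"

fun scale4 :: "complex \<Rightarrow> vec4 \<Rightarrow> vec4" where
  "scale4 z (a, b, c, d) = (z * a, z * b, z * c, z * d)"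

lemma scale4_add_right: "scale4 z (u + v) = scale4 z u + scale4 z v"
  and scale4_add_left: "scale4 (y + z) v = scale4 y v + scale4 z v"
  and scale4_scale4: "scale4 y (scale4 z v) = scale4 (y * z) v"
  and scale4_one: "scale4 1 v = v"
  and scale4_zero: "scale4 0 v = 0" "scale4 z 0 = 0"
  by (cases u; cases v; simp add: distrib_left distrib_right zero_prod_def)+

text \<open>The action of the generators on a vector \<open>x\<close> with \<open>X\<^sup>\<lambda> x = \<chi>(X\<^sup>\<lambda>) x\<close> and \<open>T\<^sub>1 x = q x\<close>, written in the
  coordinates of \<open>x\<close>, \<open>T\<^sub>2 x\<close>, \<open>y\<close>, \<open>T\<^sub>2 y\<close>, where \<open>y = T\<^sub>1 T\<^sub>2 x - q T\<^sub>2 x - x\<close>. The factor \<open>2 q\<close> is \<open>q - q\<^sup>-\<^sup>1\<close>.\<close>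

fun gen_op :: "complex \<Rightarrow> (wt \<Rightarrow> complex) \<Rightarrow> gen \<Rightarrow> vec4 \<Rightarrow> vec4" where
  "gen_op q \<chi> (GenT Node1) (a, b, c, d) = (q * a + b + d, q * b, q * c + b + d, q * d)"
| "gen_op q \<chi> (GenT Node2) (a, b, c, d) = (b, a + 2 * q * b, d, c + 2 * q * d)"
| "gen_op q \<chi> (GenX l) (a, b, c, d) =
    (\<chi> l * (a + 2 * q * of_int (snd l) * b), \<chi> l * b,
     \<chi> (srefl Node1 l) * (c + 2 * q * of_int (snd l) * d), \<chi> (srefl Node1 l) * d)"

lemma gen_op_add: "gen_op q \<chi> g (u + v) = gen_op q \<chi> g u + gen_op q \<chi> g v"
  by (cases "(q, \<chi>, g, u)" rule: gen_op.cases; cases v) (simp_all add: algebra_simps)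

lemma gen_op_scale: "gen_op q \<chi> g (scale4 z v) = scale4 z (gen_op q \<chi> g v)"
  by (cases "(q, \<chi>, g, v)" rule: gen_op.cases) (simp_all add: algebra_simps)

lemma gen_op_zero: "gen_op q \<chi> g 0 = 0"
  using gen_op_scale[of q \<chi> g 0 0] by (simp add: scale4_zero)

definition word_op :: "complex \<Rightarrow> (wt \<Rightarrow> complex) \<Rightarrow> gen list \<Rightarrow> vec4 \<Rightarrow> vec4" where
  "word_op q \<chi> = foldr (gen_op q \<chi>)"

lemma word_op_append: "word_op q \<chi> (u @ w) v = word_op q \<chi> u (word_op q \<chi> w v)"
  by (simp add: word_op_def)

lemma word_op_Nil: "word_op q \<chi> [] v = v"
  and word_op_Cons: "word_op q \<chi> (g # w) v = gen_op q \<chi> g (word_op q \<chi> w v)"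
  by (simp_all add: word_op_def)

lemma word_op_linear:
  "word_op q \<chi> w (u + v) = word_op q \<chi> w u + word_op q \<chi> w v"
  "word_op q \<chi> w (scale4 z v) = scale4 z (word_op q \<chi> w v)"
  "word_op q \<chi> w 0 = 0"
  by (induction w) (simp_all add: word_op_Nil word_op_Cons gen_op_add gen_op_scale gen_op_zero)

definition lin_ext :: "('k \<Rightarrow> vec4) \<Rightarrow> ('k \<Rightarrow>\<^sub>0 complex) \<Rightarrow> vec4" where
  "lin_ext g f = (\<Sum>k\<in>Poly_Mapping.keys f. scale4 (Poly_Mapping.lookup f k) (g k))"

lemma lin_ext_superset:
  assumes "finite K" "Poly_Mapping.keys f \<subseteq> K"
  shows "lin_ext g f = (\<Sum>k\<in>K. scale4 (Poly_Mapping.lookup f k) (g k))"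
  unfolding lin_ext_def
  by (rule sum.mono_neutral_left) (use assms in \<open>auto simp: in_keys_iff scale4_zero\<close>)

lemma lin_ext_add: "lin_ext g (e + f) = lin_ext g e + lin_ext g f"
proof -
  let ?K = "Poly_Mapping.keys e \<union> Poly_Mapping.keys f"
  show ?thesis
    using keys_add[of e f]
    by (simp add: lin_ext_superset[of ?K] lookup_add scale4_add_left sum.distrib)
qed

lemma lin_ext_zero: "lin_ext g 0 = 0"
  by (simp add: lin_ext_def)

lemma lin_ext_diff: "lin_ext g (e - f) = lin_ext g e - lin_ext g f"
  using lin_ext_add[of g "e - f" f] by (simp add: eq_diff_eq)

lemma lin_ext_single: "lin_ext g (Poly_Mapping.single k z) = scale4 z (g k)"
  by (cases "z = 0") (simp_all add: lin_ext_def scale4_zero)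

lemma lin_ext_fun_add: "lin_ext (\<lambda>k. g k + h k) f = lin_ext g f + lin_ext h f"
  by (simp add: lin_ext_def scale4_add_right sum.distrib)

lemma lin_ext_fun_diff: "lin_ext (\<lambda>k. g k - h k) f = lin_ext g f - lin_ext h f"
  using lin_ext_fun_add[of "\<lambda>k. g k - h k" h f] by (simp add: eq_diff_eq)

lemma lin_ext_fun_scale: "lin_ext (\<lambda>k. scale4 z (g k)) f = scale4 z (lin_ext g f)"
  by (induction f rule: poly_mapping_single_induct)
    (simp_all add: lin_ext_zero lin_ext_add lin_ext_single scale4_add_right scale4_scale4 scale4_zero mult.commute)

lemma lin_ext_shift: "lin_ext g (f * ga_X m) = lin_ext (\<lambda>l. g (l + m)) f"
  by (induction f rule: poly_mapping_single_induct)
    (simp_all add: lin_ext_zero lin_ext_add lin_ext_single distrib_right mult_single)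

text \<open>The quotient \<open>f = (X\<^sup>\<lambda> - X\<^bsup>s\<^sub>i\<lambda>\<^esup>) / (1 - X\<^bsup>-\<alpha>\<^sub>i\<^esup>)\<close> need not be computed. Summing over \<open>f\<close> a function of the form
  \<open>\<mu> \<mapsto> g \<mu> - g (\<mu> - \<alpha>\<^sub>i)\<close> amounts to summing \<open>g\<close> over \<open>f (1 - X\<^bsup>-\<alpha>\<^sub>i\<^esup>)\<close>, so it telescopes.\<close>

lemma lin_ext_dem_quot:
  assumes "is_dem_quot i l f"
  shows "lin_ext (\<lambda>m. g m - g (m - sroot i)) f = g l - g (srefl i l)"
proof -
  have "lin_ext g (f * (1 - ga_X (- sroot i))) = lin_ext g (ga_X l - ga_X (srefl i l))"
    using assms by (simp only: is_dem_quot_def)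
  then show ?thesis
    by (simp add: right_diff_distrib lin_ext_diff lin_ext_shift lin_ext_single scale4_one lin_ext_fun_diff)
qed

definition free_op :: "complex \<Rightarrow> (wt \<Rightarrow> complex) \<Rightarrow> free_alg \<Rightarrow> vec4 \<Rightarrow> vec4" where
  "free_op q \<chi> a v = lin_ext (\<lambda>w. word_op q \<chi> w v) a"

lemma free_op_add: "free_op q \<chi> (a + b) v = free_op q \<chi> a v + free_op q \<chi> b v"
  and free_op_diff: "free_op q \<chi> (a - b) v = free_op q \<chi> a v - free_op q \<chi> b v"
  and free_op_zero: "free_op q \<chi> 0 v = 0"
  and free_op_add_right: "free_op q \<chi> a (u + v) = free_op q \<chi> a u + free_op q \<chi> a v"
  and free_op_scale_right: "free_op q \<chi> a (scale4 z v) = scale4 z (free_op q \<chi> a v)"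
  by (simp_all add: free_op_def lin_ext_add lin_ext_diff lin_ext_zero word_op_linear lin_ext_fun_add lin_ext_fun_scale)

lemma free_op_zero_right: "free_op q \<chi> a 0 = 0"
  using free_op_scale_right[of q \<chi> a 0 0] by (simp add: scale4_zero)

lemma free_op_single: "free_op q \<chi> (Poly_Mapping.single w z) v = scale4 z (word_op q \<chi> w v)"
  by (simp add: free_op_def lin_ext_single)

lemma free_op_mult: "free_op q \<chi> (a * b) v = free_op q \<chi> a (free_op q \<chi> b v)"
proof (induction a rule: poly_mapping_single_induct)
  case (add a w z)
  have "free_op q \<chi> (Poly_Mapping.single w z * b) v = free_op q \<chi> (Poly_Mapping.single w z) (free_op q \<chi> b v)"
    by (induction b rule: poly_mapping_single_induct)
      (simp_all add: free_op_zero free_op_zero_right distrib_left free_op_add free_op_add_right mult_single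
        free_op_single plus_list_def word_op_append word_op_linear scale4_scale4)
  with add show ?case by (simp add: distrib_right free_op_add)
qed (simp add: free_op_zero)

lemma free_op_scal: "free_op q \<chi> (free_scal z) v = scale4 z v"
  and free_op_T: "free_op q \<chi> (free_T i) v = gen_op q \<chi> (GenT i) v"
  and free_op_X: "free_op q \<chi> (free_X l) v = gen_op q \<chi> (GenX l) v"
  by (simp_all add: free_scal_def free_T_def free_X_def free_op_single word_op_Nil word_op_Cons scale4_one)

lemma free_op_one: "free_op q \<chi> 1 v = v"
  using free_op_scal[of q \<chi> 1 v] by (simp add: free_scal_one scale4_one)

lemma free_op_ga: "free_op q \<chi> (free_ga f) v = lin_ext (\<lambda>l. gen_op q \<chi> (GenX l) v) f"
proof -
  have "free_op q \<chi> (\<Sum>l\<in>K. free_scal (h l) * free_X l) v = (\<Sum>l\<in>K. scale4 (h l) (gen_op q \<chi> (GenX l) v))"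
    if "finite K" for K h
    using that by induction (simp_all add: free_op_zero free_op_add free_op_mult free_op_scal free_op_X)
  then show ?thesis by (simp add: free_ga_def lin_ext_def)
qed

context special_weight
begin

text \<open>The Bernstein relation for all weights at once: it suffices to write \<open>(q - q\<^sup>-\<^sup>1) X\<^sup>\<mu> v\<close> as a
  difference \<open>g \<mu> - g (\<mu> - \<alpha>\<^sub>i)\<close>. The function \<open>g\<close> is an antidifference found by comparing coefficients:
  for \<open>\<alpha>\<^sub>1\<close>, where \<open>\<chi>\<close> changes sign under the shift, it has the same degree in \<open>\<mu>\<close> as the summand; for
  \<open>\<alpha>\<^sub>2\<close>, where \<open>\<chi>\<close> is invariant, the degree rises by one.\<close>

lemma Bernstein_op:
  assumes "is_dem_quot i l f"
  shows "gen_op q \<chi> (GenX l) (gen_op q \<chi> (GenT i) v)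
    = gen_op q \<chi> (GenT i) (gen_op q \<chi> (GenX (srefl i l)) v)
      + scale4 (q - inverse q) (lin_ext (\<lambda>m. gen_op q \<chi> (GenX m) v) f)"
proof -
  obtain a b c d where v: "v = (a, b, c, d)" by (cases v) auto
  have telescope: ?thesis
    if step: "\<And>m. g m - g (m - sroot i) = scale4 (q - inverse q) (gen_op q \<chi> (GenX m) v)"
      and ends: "gen_op q \<chi> (GenX l) (gen_op q \<chi> (GenT i) v)
        = gen_op q \<chi> (GenT i) (gen_op q \<chi> (GenX (srefl i l)) v) + (g l - g (srefl i l))" for g
  proof -
    have "g l - g (srefl i l) = scale4 (q - inverse q) (lin_ext (\<lambda>m. gen_op q \<chi> (GenX m) v) f)"
      using lin_ext_dem_quot[OF assms, of g] by (simp only: step lin_ext_fun_scale)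
    then show ?thesis using ends by simp
  qed
  show ?thesis
  proof (cases i)
    case Node1
    have s: "srefl Node1 (m - sroot Node1) = srefl Node1 m + sroot Node1" for m
      by (cases m) (simp add: srefl_def wscale_def)
    have shift: "\<chi> (m - sroot Node1) = - \<chi> m" "\<chi> (srefl Node1 (m - sroot Node1)) = - \<chi> (srefl Node1 m)" for m
      by (simp_all only: s chi_diff chi_add root1) simp_all
    define g where "g m = (\<chi> m * (q * a + (1 - 2 * of_int (snd m)) * b), \<chi> m * (q * b),
      \<chi> (srefl Node1 m) * (q * c + (1 - 2 * of_int (snd m)) * d), \<chi> (srefl Node1 m) * (q * d))" for m
    have snd_refl: "snd (srefl Node1 l) = fst l + snd l" by (simp add: srefl_def wscale_def)
    show ?thesis
    proof (rule telescope)
      show "g m - g (m - sroot i) = scale4 (q - inverse q) (gen_op q \<chi> (GenX m) v)" for m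
        unfolding Node1 v g_def by (simp add: shift inverse_q algebra_simps q_q del: sroot.simps) simp
      show "gen_op q \<chi> (GenX l) (gen_op q \<chi> (GenT i) v)
        = gen_op q \<chi> (GenT i) (gen_op q \<chi> (GenX (srefl i l)) v) + (g l - g (srefl i l))"
        unfolding Node1 v g_def by (simp add: snd_refl algebra_simps q_q)
    qed
  next
    case Node2
    have s: "srefl Node1 (m - sroot Node2) = srefl Node1 m - (sroot Node1 + (sroot Node1 + sroot Node2))" for m
      by (cases m) (simp add: srefl_def wscale_def)
    have shift: "\<chi> (m - sroot Node2) = \<chi> m" "\<chi> (srefl Node1 (m - sroot Node2)) = \<chi> (srefl Node1 m)" for m
      by (simp_all only: s chi_diff chi_add root1 root2) simp_all
    define g where "g m = (\<chi> m * ((q * a - 2 * b) * of_int (snd m) - b * (of_int (snd m))\<^sup>2), \<chi> m * (q * b * of_int (snd m)),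
      \<chi> (srefl Node1 m) * ((q * c - 2 * d) * of_int (snd m) - d * (of_int (snd m))\<^sup>2),
      \<chi> (srefl Node1 m) * (q * d * of_int (snd m)))" for m
    have snd_refl: "snd (srefl Node2 l) = - snd l" by (simp add: srefl_def wscale_def)
    show ?thesis
    proof (rule telescope)
      show "g m - g (m - sroot i) = scale4 (q - inverse q) (gen_op q \<chi> (GenX m) v)" for m
        unfolding Node2 v g_def by (simp add: shift inverse_q algebra_simps q_q power2_eq_square del: sroot.simps) simp
      show "gen_op q \<chi> (GenX l) (gen_op q \<chi> (GenT i) v)
        = gen_op q \<chi> (GenT i) (gen_op q \<chi> (GenX (srefl i l)) v) + (g l - g (srefl i l))"
        unfolding Node2 v g_def
        by (simp add: snd_refl chi_srefl2 chi_reflected_srefl2 algebra_simps q_q power2_eq_square)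
    qed
  qed
qed

lemma relator_op:
  assumes "a \<in> hecke_relators q"
  shows "free_op q \<chi> a v = 0"
proof -
  obtain x y z w where v: "v = (x, y, z, w)" by (cases v) auto
  note ops = free_op_diff free_op_add free_op_mult free_op_one free_op_scal free_op_T free_op_X free_op_ga
  consider "a = free_X 0 - 1"
    | l m where "a = free_X l * free_X m - free_X (l + m)"
    | i where "a = free_T i * free_T i - (free_scal (q - inverse q) * free_T i + 1)"
    | "a = free_T Node1 * free_T Node2 * free_T Node1 * free_T Node2
        - free_T Node2 * free_T Node1 * free_T Node2 * free_T Node1"
    | l i f where "is_dem_quot i l f"
      "a = free_X l * free_T i
        - (free_T i * free_X (srefl i l) + free_scal (q - inverse q) * free_ga f)"
    using assms unfolding hecke_relators_def by blast
  then show ?thesis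
  proof cases
    case 1
    then show ?thesis by (simp add: ops v chi_zero srefl_zero)
  next
    case 2
    then have "free_op q \<chi> a v = gen_op q \<chi> (GenX l) (gen_op q \<chi> (GenX m) v) - gen_op q \<chi> (GenX (l + m)) v"
      by (simp only: ops)
    then show ?thesis by (simp add: v chi_add srefl_add algebra_simps zero_prod_def)
  next
    case 3
    then have "free_op q \<chi> a v = gen_op q \<chi> (GenT i) (gen_op q \<chi> (GenT i) v)
        - (scale4 (q - inverse q) (gen_op q \<chi> (GenT i) v) + v)"
      by (simp only: ops)
    then show ?thesis by (cases i) (simp_all add: v inverse_q algebra_simps q_q zero_prod_def)
  next
    case 4
    show ?thesis by (simp only: 4 ops) (simp add: v algebra_simps q_q zero_prod_def)
  next
    case 5
    then show ?thesis by (simp only: ops Bernstein_op) simp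
  qed
qed

lemma hecke_ideal_op: "a \<in> hecke_ideal q \<Longrightarrow> free_op q \<chi> a v = 0"
proof -
  have "ideal {a. \<forall>v. free_op q \<chi> a v = 0} free_ring"
  proof (rule idealI[OF ring_free_ring])
    show "subgroup {a. \<forall>v. free_op q \<chi> a v = 0} (add_monoid free_ring)"
    proof (rule group.subgroupI)
      show "group (add_monoid free_ring)"
        by (rule abelian_group.a_group[OF ring.is_abelian_group[OF ring_free_ring]])
      fix a assume a: "a \<in> {a. \<forall>v. free_op q \<chi> a v = 0}"
      have "inv\<^bsub>add_monoid free_ring\<^esub> a = - a"
        using abelian_group.minus_equality[OF ring.is_abelian_group[OF ring_free_ring], of "- a" a]
        by (simp add: a_inv_def)
      then show "inv\<^bsub>add_monoid free_ring\<^esub> a \<in> {a. \<forall>v. free_op q \<chi> a v = 0}"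
        using a free_op_diff[of q \<chi> 0 a] by (simp add: free_op_zero)
    qed (auto simp: free_op_add intro: exI[of _ 0] free_op_zero)
  qed (simp_all add: free_op_mult free_op_zero_right del: split_paired_All)
  moreover have "hecke_relators q \<subseteq> {a. \<forall>v. free_op q \<chi> a v = 0}" using relator_op by blast
  ultimately have "hecke_ideal q \<subseteq> {a. \<forall>v. free_op q \<chi> a v = 0}"
    unfolding hecke_ideal_def by (rule ring.genideal_minimal[OF ring_free_ring])
  then show "a \<in> hecke_ideal q \<Longrightarrow> free_op q \<chi> a v = 0" by blast
qed

text \<open>A class acts through any representative; the choice does not matter because the whole ideal
  of relations acts by zero.\<close>

definition model :: "(hecke_elt, vec4) module" where
  "model = \<lparr>carrier = UNIV, monoid.mult = undefined, monoid.one = undefined, ring.zero = 0, ring.add = (+),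
     module.smult = (\<lambda>h. free_op q \<chi> (SOME a. h = hecke_cls q a))\<rparr>"

lemma model_simps [simp]: "carrier model = UNIV" "\<zero>\<^bsub>model\<^esub> = 0" "u \<oplus>\<^bsub>model\<^esub> v = u + v"
  by (simp_all add: model_def)

lemma smult_model: "hecke_cls q a \<odot>\<^bsub>model\<^esub> v = free_op q \<chi> a v"
proof -
  have "hecke_cls q a = hecke_cls q (SOME b. hecke_cls q a = hecke_cls q b)" by (rule someI) (rule refl)
  then show ?thesis
    using hecke_ideal_op[of "a - (SOME b. hecke_cls q a = hecke_cls q b)" v]
    by (simp add: model_def hecke_cls_eq_iff free_op_diff)
qed

lemma smult_model_gens:
  "hscal q z \<odot>\<^bsub>model\<^esub> v = scale4 z v"
  "hT q i \<odot>\<^bsub>model\<^esub> v = gen_op q \<chi> (GenT i) v"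
  "hX q l \<odot>\<^bsub>model\<^esub> v = gen_op q \<chi> (GenX l) v"
  by (simp_all add: hscal_def hT_def hX_def smult_model free_op_scal free_op_T free_op_X)

lemma left_module_model: "left_module (hecke q) model"
proof (intro left_module.intro left_module_axioms.intro ring_hecke)
  show "abelian_group model"
  proof (rule abelian_groupI)
    show "\<exists>v\<in>carrier model. v \<oplus>\<^bsub>model\<^esub> u = \<zero>\<^bsub>model\<^esub>" for u
      by (rule bexI[of _ "- u"]) simp_all
  qed (simp_all add: ac_simps)
  show "\<one>\<^bsub>hecke q\<^esub> \<odot>\<^bsub>model\<^esub> v = v" for v
    by (simp add: smult_model free_op_one flip: hecke_cls_one)
next
  fix g h u v assume "g \<in> carrier (hecke q)" "h \<in> carrier (hecke q)"
  then obtain a b where ab: "g = hecke_cls q a" "h = hecke_cls q b" by (metis hecke_carrierE)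
  show "(g \<oplus>\<^bsub>hecke q\<^esub> h) \<odot>\<^bsub>model\<^esub> v = g \<odot>\<^bsub>model\<^esub> v \<oplus>\<^bsub>model\<^esub> h \<odot>\<^bsub>model\<^esub> v"
    by (simp add: ab smult_model free_op_add flip: hecke_cls_add)
  show "(g \<otimes>\<^bsub>hecke q\<^esub> h) \<odot>\<^bsub>model\<^esub> v = g \<odot>\<^bsub>model\<^esub> (h \<odot>\<^bsub>model\<^esub> v)"
    by (simp add: ab smult_model free_op_mult flip: hecke_cls_mult)
  show "g \<odot>\<^bsub>model\<^esub> (u \<oplus>\<^bsub>model\<^esub> v) = g \<odot>\<^bsub>model\<^esub> u \<oplus>\<^bsub>model\<^esub> g \<odot>\<^bsub>model\<^esub> v"
    by (simp add: ab smult_model free_op_add_right)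
qed simp_all

end

section \<open>Modules over the affine Hecke algebra\<close>

locale hecke_module = left_module "hecke q" L
  for q :: complex and L :: "(hecke_elt, 'l) module"
begin

abbreviation sc :: "complex \<Rightarrow> 'l \<Rightarrow> 'l" where "sc z u \<equiv> hscal q z \<odot>\<^bsub>L\<^esub> u"
abbreviation opT :: "node \<Rightarrow> 'l \<Rightarrow> 'l" where "opT i u \<equiv> hT q i \<odot>\<^bsub>L\<^esub> u"
abbreviation opX :: "wt \<Rightarrow> 'l \<Rightarrow> 'l" where "opX l u \<equiv> hX q l \<odot>\<^bsub>L\<^esub> u"

lemma smult_in: "h \<in> carrier (hecke q) \<Longrightarrow> u \<in> carrier L \<Longrightarrow> h \<odot>\<^bsub>L\<^esub> u \<in> carrier L"
  by (rule lm_smult_closed)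

lemma sc_in [simp]: "u \<in> carrier L \<Longrightarrow> sc z u \<in> carrier L"
  and opT_in [simp]: "u \<in> carrier L \<Longrightarrow> opT i u \<in> carrier L"
  and opX_in [simp]: "u \<in> carrier L \<Longrightarrow> opX l u \<in> carrier L"
  by (simp_all add: smult_in)

lemma sc_add: "u \<in> carrier L \<Longrightarrow> sc (y + z) u = sc y u \<oplus>\<^bsub>L\<^esub> sc z u"
  by (simp add: hscal_add lm_smult_l_distr)

lemma sc_sc: "u \<in> carrier L \<Longrightarrow> sc y (sc z u) = sc (y * z) u"
  by (simp add: hscal_mult lm_smult_assoc)

lemma sc_one: "u \<in> carrier L \<Longrightarrow> sc 1 u = u"
  by (simp add: hscal_one lm_smult_one)

lemma sc_zero: "u \<in> carrier L \<Longrightarrow> sc 0 u = \<zero>\<^bsub>L\<^esub>"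
  by (simp add: hscal_zero)

lemma smult_sc: "h \<in> carrier (hecke q) \<Longrightarrow> u \<in> carrier L \<Longrightarrow> h \<odot>\<^bsub>L\<^esub> sc z u = sc z (h \<odot>\<^bsub>L\<^esub> u)"
  by (metis hscal_central hscal_closed lm_smult_assoc)

lemmas op_sc = smult_sc[OF hT_closed] smult_sc[OF hX_closed]

lemma minus_sc: "u \<in> carrier L \<Longrightarrow> \<ominus>\<^bsub>L\<^esub> u = sc (- 1) u"
  by (simp add: hscal_minus smult_l_minus sc_one)

lemma opX_opX: "u \<in> carrier L \<Longrightarrow> opX l (opX m u) = opX (l + m) u"
  by (simp flip: lm_smult_assoc add: hX_mult)

lemma opX_zero: "u \<in> carrier L \<Longrightarrow> opX 0 u = u"
  by (simp add: hX_zero lm_smult_one)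

lemma opT_opT: "u \<in> carrier L \<Longrightarrow> opT i (opT i u) = sc (q - inverse q) (opT i u) \<oplus>\<^bsub>L\<^esub> u"
  by (simp flip: lm_smult_assoc add: hT_square lm_smult_l_distr lm_smult_one)

lemma opT_braid:
  assumes "u \<in> carrier L"
  shows "opT Node1 (opT Node2 (opT Node1 (opT Node2 u))) = opT Node2 (opT Node1 (opT Node2 (opT Node1 u)))"
  using arg_cong[OF hT_braid[of q], of "\<lambda>h. h \<odot>\<^bsub>L\<^esub> u"] assms by (simp add: lm_smult_assoc)

lemma opX_opT_one:
  assumes "coroot_pairing l i = 1" "u \<in> carrier L"
  shows "opX l (opT i u) = opT i (opX (srefl i l) u) \<oplus>\<^bsub>L\<^esub> sc (q - inverse q) (opX l u)"
  using arg_cong[OF hX_hT_pairing_one[OF assms(1), of q], of "\<lambda>h. h \<odot>\<^bsub>L\<^esub> u"] assms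
  by (simp add: lm_smult_assoc lm_smult_l_distr)

lemma opX_opT_zero:
  assumes "coroot_pairing l i = 0" "u \<in> carrier L"
  shows "opX l (opT i u) = opT i (opX l u)"
  using arg_cong[OF hX_hT_pairing_zero[OF assms(1), of q], of "\<lambda>h. h \<odot>\<^bsub>L\<^esub> u"] assms
  by (simp add: lm_smult_assoc)

text \<open>The fundamental weights generate the weight lattice.\<close>

lemma eigenvector_all_weights:
  assumes u: "u \<in> carrier L" and \<chi>: "\<chi> \<in> torus"
    and "opX (1, 0) u = sc (\<chi> (1, 0)) u" "opX (0, 1) u = sc (\<chi> (0, 1)) u"
  shows "opX l u = sc (\<chi> l) u"
proof -
  have nz: "\<chi> l \<noteq> 0" and mult: "\<chi> (l + m) = \<chi> l * \<chi> m" for l m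
    using \<chi> by (auto simp: torus_def simp del: split_paired_All)
  have one: "\<chi> 0 = 1" using mult[of 0 0] nz[of 0] by simp
  show ?thesis
  proof (induction l rule: int_pair_induct)
    case zero then show ?case by (simp add: opX_zero u one sc_one)
  next
    case (add l m)
    then show ?case
      using opX_opX[OF u, of l m] smult_sc[OF hX_closed u] by (simp add: u sc_sc mult mult.commute)
  next
    case (minus l)
    have "u = opX (- l) (opX l u)" using opX_opX[OF u, of "- l" l] by (simp add: opX_zero u)
    also have "\<dots> = sc (\<chi> l) (opX (- l) u)" using minus smult_sc[OF hX_closed u] by simp
    finally have "sc (\<chi> (- l)) u = sc (\<chi> (- l) * \<chi> l) (opX (- l) u)"
      using u by (metis opX_in sc_sc)
    then show ?case using mult[of "- l" l] by (simp add: one u sc_one)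
  qed (use assms in auto)
qed

end

section \<open>The universal property of the model\<close>

locale weight_vector = special_weight q \<chi> + hecke_module q L
  for q :: complex and \<chi> :: "wt \<Rightarrow> complex" and L :: "(hecke_elt, 'l) module" +
  fixes x :: 'l
  assumes x [simp]: "x \<in> carrier L"
    and x_weight: "\<And>l. opX l x = sc (\<chi> l) x"
    and x_T: "opT Node1 x = sc q x"
begin

text \<open>For a weight vector \<open>u\<close>, the vector \<open>(T\<^sub>1 - q) u\<close> has the reflected weight. The vector \<open>T\<^sub>2 x\<close> is only
  a generalized weight vector, and the term \<open>- x\<close> corrects for that.\<close>

definition y :: 'l where
  "y = opT Node1 (opT Node2 x) \<ominus>\<^bsub>L\<^esub> sc q (opT Node2 x) \<ominus>\<^bsub>L\<^esub> x"

lemma y [simp]: "y \<in> carrier L" by (simp add: y_def)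

fun comb :: "vec4 \<Rightarrow> 'l" where
  "comb (a, b, c, d) = sc a x \<oplus>\<^bsub>L\<^esub> sc b (opT Node2 x) \<oplus>\<^bsub>L\<^esub> sc c y \<oplus>\<^bsub>L\<^esub> sc d (opT Node2 y)"

lemma comb_in [simp]: "comb v \<in> carrier L"
  by (cases v rule: comb.cases) simp

lemma comb_add: "comb u \<oplus>\<^bsub>L\<^esub> comb v = comb (u + v)"
  by (cases u rule: comb.cases; cases v rule: comb.cases) (simp add: sc_add M.a_ac)

lemma comb_scale: "sc z (comb v) = comb (scale4 z v)"
  by (cases v rule: comb.cases) (simp add: lm_smult_r_distr sc_sc)

lemma comb_diff: "comb u \<ominus>\<^bsub>L\<^esub> comb v = comb (u - v)"
proof -
  have "u + scale4 (- 1) v = u - v" by (cases u rule: comb.cases; cases v rule: comb.cases) simp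
  then show ?thesis by (simp add: a_minus_def minus_sc comb_scale comb_add)
qed

lemma smult_comb:
  assumes h: "h \<in> carrier (hecke q)"
    and "h \<odot>\<^bsub>L\<^esub> x = comb v1" "h \<odot>\<^bsub>L\<^esub> opT Node2 x = comb v2" "h \<odot>\<^bsub>L\<^esub> y = comb v3" "h \<odot>\<^bsub>L\<^esub> opT Node2 y = comb v4"
  shows "h \<odot>\<^bsub>L\<^esub> comb (a, b, c, d) = comb (scale4 a v1 + scale4 b v2 + scale4 c v3 + scale4 d v4)"
proof -
  have "h \<odot>\<^bsub>L\<^esub> comb (a, b, c, d) = sc a (h \<odot>\<^bsub>L\<^esub> x) \<oplus>\<^bsub>L\<^esub> sc b (h \<odot>\<^bsub>L\<^esub> opT Node2 x)
      \<oplus>\<^bsub>L\<^esub> sc c (h \<odot>\<^bsub>L\<^esub> y) \<oplus>\<^bsub>L\<^esub> sc d (h \<odot>\<^bsub>L\<^esub> opT Node2 y)"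
    using h by (simp add: lm_smult_r_distr smult_sc)
  then show ?thesis by (simp only: assms comb_scale comb_add)
qed

lemma comb_basis:
  "comb (1, 0, 0, 0) = x" "comb (0, 1, 0, 0) = opT Node2 x"
  "comb (0, 0, 1, 0) = y" "comb (0, 0, 0, 1) = opT Node2 y"
  by (simp_all add: sc_one sc_zero)

lemma diff_diff_solve:
  assumes "a \<in> carrier L" "b \<in> carrier L" "c \<in> carrier L"
  shows "c \<oplus>\<^bsub>L\<^esub> b \<oplus>\<^bsub>L\<^esub> (a \<ominus>\<^bsub>L\<^esub> b \<ominus>\<^bsub>L\<^esub> c) = a"
proof -
  have "a \<ominus>\<^bsub>L\<^esub> b \<ominus>\<^bsub>L\<^esub> c = a \<oplus>\<^bsub>L\<^esub> \<ominus>\<^bsub>L\<^esub> (c \<oplus>\<^bsub>L\<^esub> b)"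
    using assms by (simp add: a_minus_def M.minus_add M.a_ac)
  moreover have "w \<oplus>\<^bsub>L\<^esub> (a \<oplus>\<^bsub>L\<^esub> \<ominus>\<^bsub>L\<^esub> w) = a" if "w \<in> carrier L" for w
    using that assms M.a_comm[of a "\<ominus>\<^bsub>L\<^esub> w"] by (simp add: M.r_neg2)
  ultimately show ?thesis using assms by simp
qed

lemma smult_diff:
  "h \<in> carrier (hecke q) \<Longrightarrow> u \<in> carrier L \<Longrightarrow> v \<in> carrier L \<Longrightarrow>
    h \<odot>\<^bsub>L\<^esub> (u \<ominus>\<^bsub>L\<^esub> v) = h \<odot>\<^bsub>L\<^esub> u \<ominus>\<^bsub>L\<^esub> h \<odot>\<^bsub>L\<^esub> v"
  by (simp add: a_minus_def lm_smult_r_distr smult_r_minus smult_in)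

lemma T1_T2_x: "opT Node1 (opT Node2 x) = comb (1, q, 1, 0)"
proof -
  have "comb (1, q, 1, 0) = x \<oplus>\<^bsub>L\<^esub> sc q (opT Node2 x) \<oplus>\<^bsub>L\<^esub> y"
    by (simp add: sc_one sc_zero)
  also have "\<dots> = opT Node1 (opT Node2 x)"
    unfolding y_def by (rule diff_diff_solve) simp_all
  finally show ?thesis ..
qed

lemma T2_T2: "u \<in> carrier L \<Longrightarrow> opT Node2 (opT Node2 u) = sc (2 * q) (opT Node2 u) \<oplus>\<^bsub>L\<^esub> u"
  by (simp add: opT_opT inverse_q)

lemma T2_comb: "opT Node2 (comb v) = comb (gen_op q \<chi> (GenT Node2) v)"
proof -
  obtain a b c d where v: "v = (a, b, c, d)" by (cases v) auto
  have "opT Node2 (opT Node2 x) = comb (1, 2 * q, 0, 0)" "opT Node2 (opT Node2 y) = comb (0, 0, 1, 2 * q)"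
    by (simp_all add: T2_T2 sc_one sc_zero M.a_ac)
  from smult_comb[OF hT_closed comb_basis(2)[symmetric] this(1) comb_basis(4)[symmetric] this(2)]
  show ?thesis by (simp add: v algebra_simps del: comb.simps)
qed

lemma T1_comb_x: "opT Node1 (comb (a, b, 0, 0)) = comb (q * a + b, q * b, b, 0)"
proof -
  have "opT Node1 (comb (a, b, 0, 0)) = sc a (opT Node1 x) \<oplus>\<^bsub>L\<^esub> sc b (opT Node1 (opT Node2 x))"
    by (simp add: sc_zero lm_smult_r_distr op_sc)
  also have "opT Node1 x = comb (q, 0, 0, 0)" by (simp add: x_T sc_zero)
  finally show ?thesis unfolding T1_T2_x comb_scale comb_add by (simp add: mult.commute del: comb.simps)
qed

text \<open>The operator \<open>T\<^sub>1 - q\<close> annihilates \<open>y = (T\<^sub>1 - q) T\<^sub>2 x - x\<close>, as \<open>(T\<^sub>1 - q)\<^sup>2 = 0\<close> and \<open>T\<^sub>1 x = q x\<close>.\<close>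

lemma T1_y: "opT Node1 y = comb (0, 0, q, 0)"
proof -
  have "opT Node1 (opT Node1 (opT Node2 x)) = sc (2 * q) (opT Node1 (opT Node2 x)) \<oplus>\<^bsub>L\<^esub> opT Node2 x"
    by (simp add: opT_opT inverse_q)
  also have "\<dots> = comb (2 * q, -1, 2 * q, 0)"
    unfolding T1_T2_x unfolding comb_basis(2)[symmetric] comb_scale comb_add
    by (simp add: q_q algebra_simps del: comb.simps)
  finally have T1: "opT Node1 (opT Node1 (opT Node2 x)) = comb (2 * q, -1, 2 * q, 0)" .
  have "opT Node1 y = opT Node1 (opT Node1 (opT Node2 x)) \<ominus>\<^bsub>L\<^esub> sc q (opT Node1 (opT Node2 x)) \<ominus>\<^bsub>L\<^esub> opT Node1 x"
    unfolding y_def by (simp add: smult_diff op_sc)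
  also have "opT Node1 x = comb (q, 0, 0, 0)" by (simp add: x_T sc_zero)
  finally show ?thesis unfolding T1 unfolding T1_T2_x comb_scale comb_diff by (simp add: q_q algebra_simps del: comb.simps)
qed

lemma T2_T1_T2_x: "opT Node2 (opT Node1 (opT Node2 x)) = comb (q, -1, 0, 1)"
  unfolding T1_T2_x T2_comb by (simp add: q_q algebra_simps del: comb.simps)

text \<open>This is where the braid relation enters: it moves the outer \<open>T\<^sub>1\<close> of
  \<open>T\<^sub>1 T\<^sub>2 T\<^sub>1 T\<^sub>2 x\<close> onto the eigenvector \<open>x\<close>.\<close>

lemma T1_T2_y: "opT Node1 (opT Node2 y) = comb (1, 0, 1, q)"
proof -
  have "opT Node2 y = opT Node2 (opT Node1 (opT Node2 x)) \<ominus>\<^bsub>L\<^esub> sc q (opT Node2 (opT Node2 x)) \<ominus>\<^bsub>L\<^esub> opT Node2 x"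
    unfolding y_def by (simp add: smult_diff op_sc)
  then have "opT Node1 (opT Node2 y) = opT Node1 (opT Node2 (opT Node1 (opT Node2 x)))
      \<ominus>\<^bsub>L\<^esub> sc q (opT Node1 (opT Node2 (opT Node2 x))) \<ominus>\<^bsub>L\<^esub> opT Node1 (opT Node2 x)"
    by (simp add: smult_diff op_sc)
  also have "opT Node1 (opT Node2 (opT Node1 (opT Node2 x))) = sc q (comb (q, -1, 0, 1))"
    unfolding T2_T1_T2_x[symmetric] by (simp add: opT_braid x_T op_sc)
  also have "opT Node2 (opT Node2 x) = comb (1, 2 * q, 0, 0)"
    unfolding comb_basis(2)[symmetric] T2_comb by (simp del: comb.simps)
  finally show ?thesis
    by (simp add: T1_comb_x T1_T2_x comb_scale comb_diff q_q algebra_simps del: comb.simps)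
qed

lemma T1_comb: "opT Node1 (comb v) = comb (gen_op q \<chi> (GenT Node1) v)"
proof -
  obtain a b c d where v: "v = (a, b, c, d)" by (cases v) auto
  have "opT Node1 x = comb (q, 0, 0, 0)" by (simp add: x_T sc_zero)
  from smult_comb[OF hT_closed this T1_T2_x T1_y T1_T2_y]
  show ?thesis by (simp add: v algebra_simps del: comb.simps)
qed

lemma T_comb: "opT i (comb v) = comb (gen_op q \<chi> (GenT i) v)"
  by (cases i) (simp_all only: T1_comb T2_comb)

lemma opX_T2:
  assumes u: "u \<in> carrier L" and \<psi>: "special_weight q \<psi>" and w: "\<And>l. opX l u = sc (\<psi> l) u"
  shows "opX (a, 0) (opT Node2 u) = sc (\<psi> (a, 0)) (opT Node2 u)"
    and "opX (0, 1) (opT Node2 u) = sc (-1) (opT Node2 u) \<oplus>\<^bsub>L\<^esub> sc (- 2 * q) u"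
proof -
  interpret \<psi>: special_weight q \<psi> by fact
  show "opX (a, 0) (opT Node2 u) = sc (\<psi> (a, 0)) (opT Node2 u)"
    using u by (simp add: opX_opT_zero w op_sc)
  show "opX (0, 1) (opT Node2 u) = sc (-1) (opT Node2 u) \<oplus>\<^bsub>L\<^esub> sc (- 2 * q) u"
    using u by (simp add: opX_opT_one w op_sc \<psi>.chi_srefl2 \<psi>.chi_omega2 sc_sc inverse_q)
qed

lemma opX_omega1_T1_T2_x:
  "opX (1, 0) (opT Node1 (opT Node2 x))
    = comb (scale4 (\<chi> (1, 0)) (1, q, -1, 0))"
proof -
  have \<chi>: "special_weight q \<chi>" by unfold_locales
  have s: "srefl Node1 (1, 0) = (-1, 0) + (0, 1)" by (simp add: srefl_def wscale_def)
  have inv: "\<chi> (-1, 0) = \<chi> (1, 0)"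
    using chi_minus[of "(1, 0)"] inverse_unique[OF chi_omega1_square] by simp
  have "opX (srefl Node1 (1, 0)) (opT Node2 x) = opX (-1, 0) (opX (0, 1) (opT Node2 x))"
    by (simp only: s opX_opX[symmetric] opT_in x)
  also have "\<dots> = sc (- \<chi> (1, 0)) (opT Node2 x) \<oplus>\<^bsub>L\<^esub> sc (- 2 * q * \<chi> (1, 0)) x"
    by (simp add: opX_T2[OF x \<chi> x_weight] lm_smult_r_distr op_sc x_weight sc_sc inv mult.commute)
  also have "\<dots> = comb (- 2 * q * \<chi> (1, 0), - \<chi> (1, 0), 0, 0)"
    by (simp add: sc_zero M.a_ac)
  finally have e: "opX (srefl Node1 (1, 0)) (opT Node2 x) = comb (- 2 * q * \<chi> (1, 0), - \<chi> (1, 0), 0, 0)" .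
  have "opX (1, 0) (opT Node2 x) = comb (0, \<chi> (1, 0), 0, 0)"
    by (simp add: opX_T2[OF x \<chi> x_weight] sc_zero)
  then have "opX (1, 0) (opT Node1 (opT Node2 x))
      = opT Node1 (comb (- 2 * q * \<chi> (1, 0), - \<chi> (1, 0), 0, 0)) \<oplus>\<^bsub>L\<^esub> sc (2 * q) (comb (0, \<chi> (1, 0), 0, 0))"
    using e by (simp add: opX_opT_one inverse_q del: comb.simps)
  then show ?thesis
    by (simp add: T1_comb_x comb_scale comb_add q_q algebra_simps del: comb.simps)
qed

text \<open>By the Bernstein relation for \<open>T\<^sub>1\<close>, moving \<open>X\<^sup>\<lambda>\<close> past \<open>T\<^sub>1\<close> replaces \<open>\<lambda>\<close> by \<open>s\<^sub>1\<lambda>\<close>. With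
  \<open>eigenvector_all_weights\<close> the two fundamental weights are enough.\<close>

lemma y_weight: "opX l y = sc (\<chi> (srefl Node1 l)) y"
proof -
  have \<chi>: "special_weight q \<chi>" by unfold_locales
  have X1: "opX (1, 0) y = sc (- \<chi> (1, 0)) y"
  proof -
    have "opX (1, 0) y = comb (scale4 (\<chi> (1, 0)) (1, q, -1, 0)) \<ominus>\<^bsub>L\<^esub> sc q (comb (0, \<chi> (1, 0), 0, 0)) \<ominus>\<^bsub>L\<^esub> comb (\<chi> (1, 0), 0, 0, 0)"
      unfolding y_def
      by (simp add: smult_diff op_sc opX_omega1_T1_T2_x opX_T2[OF x \<chi> x_weight] x_weight del: comb.simps)
        (simp add: sc_zero sc_sc)
    then have "opX (1, 0) y = sc (- \<chi> (1, 0)) (comb (0, 0, 1, 0))"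
      by (simp add: comb_scale comb_diff mult.commute del: comb.simps)
    then show ?thesis by (simp only: comb_basis)
  qed
  have X2: "opX (0, 1) y = sc (- 1) y"
  proof -
    have T2: "opX (0, 1) (opT Node2 x) = comb (- 2 * q, -1, 0, 0)"
      unfolding opX_T2(2)[OF x \<chi> x_weight] by (simp add: sc_zero M.a_ac)
    have "opX (0, 1) (opT Node1 (opT Node2 x)) = comb (1, - q, -1, 0)"
      by (simp add: opX_opT_zero T2 T1_comb_x q_q algebra_simps del: comb.simps)
    then have "opX (0, 1) y = comb (1, - q, -1, 0) \<ominus>\<^bsub>L\<^esub> sc q (comb (- 2 * q, -1, 0, 0)) \<ominus>\<^bsub>L\<^esub> comb (-1, 0, 0, 0)"
      unfolding y_def
      by (simp add: smult_diff op_sc T2 x_weight chi_omega2 del: comb.simps) (simp add: sc_zero)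
    then have "opX (0, 1) y = sc (- 1) (comb (0, 0, 1, 0))"
      by (simp add: comb_scale comb_diff q_q algebra_simps del: comb.simps)
    then show ?thesis by (simp only: comb_basis)
  qed
  have "\<chi> \<circ> srefl Node1 \<in> torus" using reflected by (rule special_weight.torus)
  from eigenvector_all_weights[OF y this] X1 X2 show ?thesis
    by (simp add: chi_s1_omega1 chi_s1_omega2)
qed

lemma X_comb: "opX l (comb v) = comb (gen_op q \<chi> (GenX l) v)"
proof (induction l arbitrary: v rule: int_pair_induct)
  case zero
  show ?case by (cases v rule: comb.cases) (simp add: opX_zero chi_zero srefl_zero)
next
  case (add l m)
  have "gen_op q \<chi> (GenX (l + m)) v = gen_op q \<chi> (GenX l) (gen_op q \<chi> (GenX m) v)"
    by (cases v rule: comb.cases) (simp add: chi_add srefl_add algebra_simps)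
  then show ?case using add by (simp flip: opX_opX)
next
  case (minus l)
  have inv: "gen_op q \<chi> (GenX l) (gen_op q \<chi> (GenX (- l)) v) = v"
    by (cases v rule: comb.cases) (simp add: chi_minus srefl_minus chi_nonzero field_simps)
  have "opX (- l) (comb v) = opX (- l) (opX l (comb (gen_op q \<chi> (GenX (- l)) v)))"
    by (simp only: minus inv)
  then show ?case by (simp add: opX_opX opX_zero)
next
  case omega1
  obtain a b c d where v: "v = (a, b, c, d)" by (cases v) auto
  have \<chi>: "special_weight q \<chi>" by unfold_locales
  note y_weight' = y_weight[folded comp_apply[of \<chi> "srefl Node1"]]
  have "opX (1, 0) x = comb (\<chi> (1, 0), 0, 0, 0)" "opX (1, 0) (opT Node2 x) = comb (0, \<chi> (1, 0), 0, 0)"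
    "opX (1, 0) y = comb (0, 0, - \<chi> (1, 0), 0)" "opX (1, 0) (opT Node2 y) = comb (0, 0, 0, - \<chi> (1, 0))"
    by (simp_all add: x_weight y_weight opX_T2[OF x \<chi> x_weight] opX_T2[OF y reflected y_weight']
        chi_s1_omega1 sc_zero)
  from smult_comb[OF hX_closed this]
  show ?case by (simp add: v chi_s1_omega1 algebra_simps del: comb.simps)
next
  case omega2
  obtain a b c d where v: "v = (a, b, c, d)" by (cases v) auto
  have \<chi>: "special_weight q \<chi>" by unfold_locales
  note y_weight' = y_weight[folded comp_apply[of \<chi> "srefl Node1"]]
  have "opX (0, 1) x = comb (- 1, 0, 0, 0)" "opX (0, 1) (opT Node2 x) = comb (- 2 * q, - 1, 0, 0)"
    "opX (0, 1) y = comb (0, 0, - 1, 0)" "opX (0, 1) (opT Node2 y) = comb (0, 0, - 2 * q, - 1)"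
    by (simp_all add: x_weight y_weight opX_T2(2)[OF x \<chi> x_weight] opX_T2(2)[OF y reflected y_weight']
        chi_omega2 chi_s1_omega2 sc_zero M.a_ac)
  from smult_comb[OF hX_closed this]
  show ?case by (simp add: v chi_s1_omega2 chi_omega2 algebra_simps del: comb.simps)
qed

text \<open>The model is the universal module generated by a vector like \<open>x\<close>: in every module the
  computations above come out the same.\<close>

lemma comb_hom: "comb \<in> left_module_hom (hecke q) model L"
proof (rule left_module_homI)
  fix h v assume "h \<in> carrier (hecke q)"
  then have "\<forall>v. comb (h \<odot>\<^bsub>model\<^esub> v) = h \<odot>\<^bsub>L\<^esub> comb v"
  proof (induction h rule: hecke_induct)
    case (add g h)
    then show ?case
      using left_module.lm_smult_l_distr[OF left_module_model]
      by (simp add: lm_smult_l_distr comb_add[symmetric] del: split_paired_All comb.simps)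
  next
    case (mult g h)
    then show ?case
      using left_module.lm_smult_assoc[OF left_module_model]
      by (simp add: lm_smult_assoc del: split_paired_All comb.simps)
  qed (simp_all add: smult_model_gens comb_scale T_comb X_comb del: split_paired_All comb.simps)
  then show "comb (h \<odot>\<^bsub>model\<^esub> v) = h \<odot>\<^bsub>L\<^esub> comb v" by blast
qed (simp_all add: comb_add)

end

section \<open>The model as a module: symmetry and irreducibility\<close>

context special_weight
begin

text \<open>A nonzero submodule contains a nonzero multiple of the first or of the third basis vector, and
  each of these generates: \<open>T\<^sub>2\<close> sends it to the next basis vector, and \<open>T\<^sub>1\<close> leads from there to the
  other half.\<close>

lemma irreducible_model: "irreducible_module (hecke q) model"
  unfolding irreducible_module_def
proof (intro conjI allI impI left_module_model)
  have "(1, 0, 0, 0) \<noteq> (0 :: vec4)" by (simp add: zero_prod_def)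
  then show "carrier model \<noteq> {\<zero>\<^bsub>model\<^esub>}" by (metis UNIV_I model_simps(1,2) singletonD)
  fix U assume U: "submodule U (hecke q) model"
  have add: "u + v \<in> U" if "u \<in> U" "v \<in> U" for u v using submodule_add[OF U that] by simp
  have scale: "scale4 z u \<in> U" and gen: "gen_op q \<chi> g u \<in> U" if "u \<in> U" for u z g
    using submodule.smult_closed[OF U hscal_closed that] submodule.smult_closed[OF U hT_closed that]
      submodule.smult_closed[OF U hX_closed that]
    by (cases g; simp add: smult_model_gens)+
  have e1_all: "U = UNIV" if e1: "(1, 0, 0, 0) \<in> U"
  proof -
    have e2: "(0, 1, 0, 0) \<in> U" using gen[OF e1, of "GenT Node2"] by simp
    have "(1, q, 1, 0) \<in> U" using gen[OF e2, of "GenT Node1"] by simp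
    from add[OF add[OF this scale[OF e1, of "- 1"]] scale[OF e2, of "- q"]]
    have e3: "(0, 0, 1, 0) \<in> U" by simp
    have e4: "(0, 0, 0, 1) \<in> U" using gen[OF e3, of "GenT Node2"] by simp
    have "(a, b, c, d) \<in> U" for a b c d
      using add[OF add[OF scale[OF e1, of a] scale[OF e2, of b]] add[OF scale[OF e3, of c] scale[OF e4, of d]]] by simp
    then show ?thesis by auto
  qed
  have e3_all: "U = UNIV" if e3: "(0, 0, 1, 0) \<in> U"
  proof -
    have e4: "(0, 0, 0, 1) \<in> U" using gen[OF e3, of "GenT Node2"] by simp
    have "(1, 0, 1, q) \<in> U" using gen[OF e4, of "GenT Node1"] by simp
    from add[OF add[OF this scale[OF e3, of "- 1"]] scale[OF e4, of "- q"]]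
    show ?thesis by (intro e1_all) simp
  qed
  show "U = {\<zero>\<^bsub>model\<^esub>} \<or> U = carrier model"
  proof (cases "U \<subseteq> {0}")
    case True
    then show ?thesis using submodule_zero[OF U] by auto
  next
    case False
    then obtain a b c d where u: "(a, b, c, d) \<in> U" and nz: "(a, b, c, d) \<noteq> 0"
      by (metis prod_cases4 singletonI subsetI)
    let ?\<epsilon> = "\<chi> (1, 0)"
    have s1: "\<chi> (srefl Node1 (1, 0)) = - ?\<epsilon>" and s2: "\<chi> (srefl Node1 (0, 1)) = -1"
      by (rule chi_s1_omega1, rule chi_s1_omega2)
    \<comment> \<open>\<open>X\<^bsup>\<omega>\<^sub>1\<^esup>\<close> separates the two weights, and \<open>X\<^bsup>\<omega>\<^sub>2\<^esup> + 1\<close> is nilpotent.\<close>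
    have p: "(2 * a, 2 * b, 0, 0) \<in> U"
      using add[OF u scale[OF gen[OF u, of "GenX (1, 0)"], of ?\<epsilon>]]
      by (simp add: s1 chi_omega1_square flip: mult.assoc)
    have m: "(0, 0, 2 * c, 2 * d) \<in> U"
      using add[OF u scale[OF gen[OF u, of "GenX (1, 0)"], of "- ?\<epsilon>"]]
      by (simp add: s1 chi_omega1_square flip: mult.assoc)
    have p': "(- 4 * q * b, 0, 0, 0) \<in> U"
      using add[OF p gen[OF p, of "GenX (0, 1)"]] by (simp add: s2 chi_omega2 mult.assoc)
    have m': "(0, 0, - 4 * q * d, 0) \<in> U"
      using add[OF m gen[OF m, of "GenX (0, 1)"]] by (simp add: s2 chi_omega2 mult.assoc)
    have e1: "U = UNIV" if "(z, 0, 0, 0) \<in> U" "z \<noteq> 0" for z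
      using scale[OF that(1), of "inverse z"] that(2) by (intro e1_all) simp
    have e3: "U = UNIV" if "(0, 0, z, 0) \<in> U" "z \<noteq> 0" for z
      using scale[OF that(1), of "inverse z"] that(2) by (intro e3_all) simp
    consider "b \<noteq> 0" | "b = 0" "a \<noteq> 0" | "d \<noteq> 0" | "d = 0" "c \<noteq> 0"
      using nz by (auto simp: zero_prod_def)
    then have "U = UNIV"
      using e1[OF p'] e3[OF m'] e1[of "2 * a"] e3[of "2 * c"] p m q_nonzero by cases simp_all
    then show ?thesis by simp
  qed
qed

end

text \<open>The construction of \<open>y\<close> from \<open>x\<close> is an involution, visible in the symmetry of the formulas for
  \<open>T\<^sub>1\<close> and \<open>T\<^sub>2\<close>; exchanging the two halves therefore exchanges \<open>\<chi>\<close> and \<open>s\<^sub>1\<chi>\<close>.\<close>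

fun swap4 :: "vec4 \<Rightarrow> vec4" where
  "swap4 (a, b, c, d) = (c, d, a, b)"

lemma swap4_linear: "swap4 (u + v) = swap4 u + swap4 v" "swap4 (scale4 z v) = scale4 z (swap4 v)"
  by (cases u rule: swap4.cases; cases v rule: swap4.cases; simp)+

lemma gen_op_swap4: "gen_op q (\<chi> \<circ> srefl Node1) g (swap4 v) = swap4 (gen_op q \<chi> g v)"
  by (cases "(q, \<chi>, g, v)" rule: gen_op.cases) (simp_all add: algebra_simps)

lemma bij_swap4: "bij swap4"
  by (rule o_bij[of swap4]) (auto simp: fun_eq_iff)

lemma (in special_weight) swap4_iso:
  "swap4 \<in> module_iso (hecke q) model (special_weight.model q (\<chi> \<circ> srefl Node1))"
proof -
  define \<psi> where "\<psi> = \<chi> \<circ> srefl Node1"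
  interpret s: special_weight q \<psi> unfolding \<psi>_def by (rule reflected)
  have "swap4 \<in> left_module_hom (hecke q) model s.model"
  proof (rule left_module_homI)
    fix h v assume "h \<in> carrier (hecke q)"
    then have "\<forall>v. swap4 (h \<odot>\<^bsub>model\<^esub> v) = h \<odot>\<^bsub>s.model\<^esub> swap4 v"
    proof (induction h rule: hecke_induct)
      case (add g h)
      then show ?case
        using left_module.lm_smult_l_distr[OF left_module_model] left_module.lm_smult_l_distr[OF s.left_module_model]
        by (simp add: swap4_linear del: split_paired_All)
    next
      case (mult g h)
      then show ?case
        using left_module.lm_smult_assoc[OF left_module_model] left_module.lm_smult_assoc[OF s.left_module_model]
        by (simp del: split_paired_All)
    qed (simp_all add: smult_model_gens s.smult_model_gens swap4_linear gen_op_swap4[where \<chi> = \<chi>, folded \<psi>_def] del: split_paired_All)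
    then show "swap4 (h \<odot>\<^bsub>model\<^esub> v) = h \<odot>\<^bsub>s.model\<^esub> swap4 v" by blast
  qed (simp_all add: swap4_linear)
  then show ?thesis using bij_swap4 by (simp add: module_iso_iff flip: \<psi>_def)
qed

section \<open>The induced modules\<close>

context special_weight
begin

interpretation K: hecke_module q model
  by (rule hecke_module.intro[OF left_module_model])

lemma parabolic_subset: "parabolic q i \<subseteq> carrier (hecke q)"
  unfolding parabolic_def by (rule hecke.generate_ring_incl) auto

lemma parabolic_gens: "hscal q a \<in> parabolic q i" "hT q i \<in> parabolic q i" "hX q l \<in> parabolic q i"
  unfolding parabolic_def by (auto intro: generate_ring.incl)

lemma parabolic_eigenvector:
  assumes "h \<in> parabolic q Node1"
  shows "\<exists>z. h \<odot>\<^bsub>model\<^esub> (1, 0, 0, 0) = (z, 0, 0, 0)"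
proof -
  have scale: "(z, 0, 0, 0) = K.sc z (1, 0, 0, 0)" for z by (simp add: smult_model_gens)
  show ?thesis using assms unfolding parabolic_def
  proof (induction rule: generate_ring.induct)
    case one
    then show ?case using K.lm_smult_one by auto
  next
    case (incl h)
    then show ?case by (auto simp: smult_model_gens)
  next
    case (a_inv h)
    then have "h \<in> carrier (hecke q)" using parabolic_subset by (auto simp: parabolic_def)
    then show ?case using a_inv.IH by (auto simp: K.smult_l_minus K.minus_sc smult_model_gens)
  next
    case (eng_add g h)
    then have "g \<in> carrier (hecke q)" "h \<in> carrier (hecke q)" using parabolic_subset by (auto simp: parabolic_def)
    then show ?case using eng_add.IH by (auto simp: K.lm_smult_l_distr)
  next
    case (eng_mult g h)
    then have gh: "g \<in> carrier (hecke q)" "h \<in> carrier (hecke q)" using parabolic_subset by (auto simp: parabolic_def)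
    obtain w z where "g \<odot>\<^bsub>model\<^esub> (1, 0, 0, 0) = (w, 0, 0, 0)" "h \<odot>\<^bsub>model\<^esub> (1, 0, 0, 0) = (z, 0, 0, 0)"
      using eng_mult.IH by blast
    then have "(g \<otimes>\<^bsub>hecke q\<^esub> h) \<odot>\<^bsub>model\<^esub> (1, 0, 0, 0) = (z * w, 0, 0, 0)"
      using gh by (simp add: K.lm_smult_assoc scale[of z] K.smult_sc[OF gh(1)]) (simp add: smult_model_gens)
    then show ?case ..
  qed
qed

text \<open>That the prescribed values on the generators of the parabolic subalgebra extend to a character
  is read off from the model: its first basis vector is a common eigenvector.\<close>

definition eigenvalue :: "hecke_elt \<Rightarrow> complex" where
  "eigenvalue = (\<lambda>h\<in>parabolic q Node1. fst (h \<odot>\<^bsub>model\<^esub> (1, 0, 0, 0)))"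

lemma eigenvalue: "h \<in> parabolic q Node1 \<Longrightarrow> h \<odot>\<^bsub>model\<^esub> (1, 0, 0, 0) = (eigenvalue h, 0, 0, 0)"
  using parabolic_eigenvector[of h] by (auto simp: eigenvalue_def)

lemma eigenvalue_gens: "eigenvalue (hscal q a) = a" "eigenvalue (hX q l) = \<chi> l" "eigenvalue (hT q Node1) = q"
  by (simp_all add: eigenvalue_def parabolic_gens smult_model_gens)

lemma ring_hom_parabolic_unique:
  assumes f: "f \<in> ring_hom (parabolic_ring q i) (ring_of_type_algebra :: complex ring)" "f \<in> extensional (parabolic q i)"
    and g: "g \<in> ring_hom (parabolic_ring q i) (ring_of_type_algebra :: complex ring)" "g \<in> extensional (parabolic q i)"
    and eq: "\<And>a. f (hscal q a) = g (hscal q a)" "\<And>l. f (hX q l) = g (hX q l)" "f (hT q i) = g (hT q i)"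
  shows "f = g"
proof (rule extensionalityI[OF f(2) g(2)])
  have add: "f (a \<oplus>\<^bsub>hecke q\<^esub> b) = f a + f b" "g (a \<oplus>\<^bsub>hecke q\<^esub> b) = g a + g b"
    and mult: "f (a \<otimes>\<^bsub>hecke q\<^esub> b) = f a * f b" "g (a \<otimes>\<^bsub>hecke q\<^esub> b) = g a * g b"
    if "a \<in> parabolic q i" "b \<in> parabolic q i" for a b
    using f(1) g(1) that by (auto simp: ring_hom_def)
  have neg: "\<ominus>\<^bsub>hecke q\<^esub> a = hscal q (- 1) \<otimes>\<^bsub>hecke q\<^esub> a" if "a \<in> parabolic q i" for a
    using that parabolic_subset[of i] by (auto simp: hscal_minus hscal_one hecke.l_minus)
  fix h assume "h \<in> parabolic q i"
  then show "f h = g h" unfolding parabolic_def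
  proof (induction rule: generate_ring.induct)
    case one
    show ?case using eq(1)[of 1] by (simp add: hscal_one)
  next
    case (incl h) then show ?case using eq by auto
  next
    case (a_inv h)
    then have h: "h \<in> parabolic q i" by (simp add: parabolic_def)
    show ?case using a_inv.IH by (simp add: neg[OF h] mult[OF parabolic_gens(1) h] eq)
  next
    case (eng_add a b)
    then show ?case using add[of a b] by (simp add: parabolic_def)
  next
    case (eng_mult a b)
    then show ?case using mult[of a b] by (simp add: parabolic_def)
  qed
qed

lemma line_char_eq: "line_char q Node1 \<chi> q = eigenvalue"
proof -
  let ?P = "parabolic q Node1"
  have P: "h \<in> carrier (hecke q)" if "h \<in> ?P" for h using that parabolic_subset by blast
  have P_add: "g \<oplus>\<^bsub>hecke q\<^esub> h \<in> ?P" and P_mult: "g \<otimes>\<^bsub>hecke q\<^esub> h \<in> ?P"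
    if "g \<in> ?P" "h \<in> ?P" for g h
    using that unfolding parabolic_def by (auto intro: generate_ring.intros)
  have P_one: "\<one>\<^bsub>hecke q\<^esub> \<in> ?P" unfolding parabolic_def by (rule generate_ring.one)
  have scale: "(z, 0, 0, 0) = K.sc z (1, 0, 0, 0)" for z by (simp add: smult_model_gens)
  have hom: "eigenvalue \<in> ring_hom (parabolic_ring q Node1) (ring_of_type_algebra :: complex ring)"
  proof (rule ring_hom_memI)
    fix g h assume "g \<in> carrier (parabolic_ring q Node1)" "h \<in> carrier (parabolic_ring q Node1)"
    then have gh: "g \<in> ?P" "h \<in> ?P" by simp_all
    have "(eigenvalue (g \<oplus>\<^bsub>hecke q\<^esub> h), 0, 0, 0) = (eigenvalue g + eigenvalue h, 0, 0, 0 :: complex)"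
      using eigenvalue[OF P_add[OF gh]] eigenvalue[OF gh(1)] eigenvalue[OF gh(2)]
      by (simp add: K.lm_smult_l_distr P gh)
    then show "eigenvalue (g \<oplus>\<^bsub>parabolic_ring q Node1\<^esub> h) = eigenvalue g \<oplus>\<^bsub>(ring_of_type_algebra :: complex ring)\<^esub> eigenvalue h"
      by simp
    have "(eigenvalue (g \<otimes>\<^bsub>hecke q\<^esub> h), 0, 0, 0) = K.sc (eigenvalue h) (eigenvalue g, 0, 0, 0)"
      unfolding eigenvalue[OF P_mult[OF gh], symmetric] eigenvalue[OF gh(1), symmetric]
      by (simp add: K.lm_smult_assoc P gh eigenvalue[OF gh(2)] scale[of "eigenvalue h"] K.smult_sc[OF P[OF gh(1)]])
    then show "eigenvalue (g \<otimes>\<^bsub>parabolic_ring q Node1\<^esub> h) = eigenvalue g \<otimes>\<^bsub>(ring_of_type_algebra :: complex ring)\<^esub> eigenvalue h"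
      by (simp add: smult_model_gens)
  next
    have "(eigenvalue \<one>\<^bsub>hecke q\<^esub>, 0, 0, 0) = (1, 0, 0, 0 :: complex)"
      using eigenvalue[OF P_one] K.lm_smult_one by simp
    then show "eigenvalue \<one>\<^bsub>parabolic_ring q Node1\<^esub> = \<one>\<^bsub>(ring_of_type_algebra :: complex ring)\<^esub>" by simp
  qed simp
  have ext: "eigenvalue \<in> extensional ?P" by (simp add: eigenvalue_def)
  show ?thesis unfolding line_char_def
  proof (rule the_equality)
    fix f assume "f \<in> ring_hom (parabolic_ring q Node1) ring_of_type_algebra \<and> f \<in> extensional ?P \<and>
      (\<forall>a. f (hscal q a) = a) \<and> (\<forall>l. f (hX q l) = \<chi> l) \<and> f (hT q Node1) = q"
    then show "f = eigenvalue"
      by (intro ring_hom_parabolic_unique[where i = Node1]) (auto simp: hom ext eigenvalue_gens)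
  qed (simp add: hom ext eigenvalue_gens)
qed

lemma line_module_simps:
  "carrier (line_module q i \<psi> c) = UNIV" "v \<oplus>\<^bsub>line_module q i \<psi> c\<^esub> w = v + w"
  "\<zero>\<^bsub>line_module q i \<psi> c\<^esub> = 0" "h \<odot>\<^bsub>line_module q i \<psi> c\<^esub> z = line_char q i \<psi> c h * z"
  by (simp_all add: line_module_def)

lemma line_extension: "scalar_extension (hecke q) (parabolic q i) (line_module q i \<psi> c)"
proof (intro scalar_extension.intro scalar_extension_axioms.intro ring_hecke parabolic_subset)
  show "abelian_group (line_module q i \<psi> c)"
  proof (rule abelian_groupI)
    show "\<exists>w\<in>carrier (line_module q i \<psi> c). w \<oplus>\<^bsub>line_module q i \<psi> c\<^esub> v = \<zero>\<^bsub>line_module q i \<psi> c\<^esub>" for v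
      by (rule bexI[of _ "- v"]) (simp_all add: line_module_simps)
  qed (simp_all add: line_module_simps ac_simps)
qed (simp add: line_module_simps)

interpretation I: scalar_extension "hecke q" "parabolic q Node1" "line_module q Node1 \<chi> q"
  by (rule line_extension)

abbreviation "ind \<equiv> induced q Node1 \<chi> q"
abbreviation "ind_gen \<equiv> induced_gen q Node1 \<chi> q"

lemma left_module_induced: "left_module (hecke q) ind"
  unfolding induced_def by (rule I.T_left_module)

lemma smult_ind_gen:
  assumes "s \<in> parabolic q Node1" "h \<in> carrier (hecke q)"
  shows "(h \<otimes>\<^bsub>hecke q\<^esub> s) \<odot>\<^bsub>ind\<^esub> ind_gen
    = pure_tensor (hecke q) (parabolic q Node1) (line_module q Node1 \<chi> q) h (eigenvalue s)"
proof -
  have s: "s \<in> carrier (hecke q)" using assms parabolic_subset by blast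
  have "(h \<otimes>\<^bsub>hecke q\<^esub> s) \<odot>\<^bsub>ind\<^esub> ind_gen
      = pure_tensor (hecke q) (parabolic q Node1) (line_module q Node1 \<chi> q) (h \<otimes>\<^bsub>hecke q\<^esub> s) 1"
    unfolding induced_def induced_gen_def
    using s assms by (subst I.smult_pure) (simp_all add: line_module_simps)
  also have "\<dots> = pure_tensor (hecke q) (parabolic q Node1) (line_module q Node1 \<chi> q) h (eigenvalue s)"
    using assms by (subst I.pure_balanced) (simp_all add: line_module_simps line_char_eq)
  finally show ?thesis .
qed

lemma weight_vector_ind_gen: "weight_vector q \<chi> ind ind_gen"
proof -
  interpret hecke_module q ind by (rule hecke_module.intro[OF left_module_induced])
  have one: "s \<odot>\<^bsub>ind\<^esub> ind_gen = pure_tensor (hecke q) (parabolic q Node1) (line_module q Node1 \<chi> q) \<one>\<^bsub>hecke q\<^esub> (eigenvalue s)"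
    if "s \<in> parabolic q Node1" for s
  proof -
    have "s \<in> carrier (hecke q)" using that parabolic_subset by blast
    then show ?thesis using smult_ind_gen[OF that, of "\<one>\<^bsub>hecke q\<^esub>"] by simp
  qed
  show ?thesis
  proof unfold_locales
    show "ind_gen \<in> carrier ind"
      unfolding induced_def induced_gen_def by (rule I.pure_closed) (simp_all add: line_module_simps)
  qed (simp_all add: one parabolic_gens eigenvalue_gens)
qed

sublocale ind: weight_vector q \<chi> ind ind_gen
  by (rule weight_vector_ind_gen)

text \<open>The universal property of the tensor product gives a map to the model that sends \<open>1 \<otimes> 1\<close> to the
  first basis vector, so \<open>1 \<otimes> 1 \<noteq> 0\<close>. The map from the model is therefore nonzero, hence injective as the
  model is irreducible, and it is surjective because \<open>1 \<otimes> 1\<close> generates the induced module.\<close>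

lemma induced_iso: "ind.comb \<in> module_iso (hecke q) model ind"
proof -
  have "scale4 (eigenvalue s * z) (1, 0, 0, 0) = s \<odot>\<^bsub>model\<^esub> scale4 z (1, 0, 0, 0)"
    if s: "s \<in> parabolic q Node1" for s z
  proof -
    have "s \<odot>\<^bsub>model\<^esub> K.sc z (1, 0, 0, 0) = K.sc z (s \<odot>\<^bsub>model\<^esub> (1, 0, 0, 0))"
      using s parabolic_subset by (intro K.smult_sc) auto
    then show ?thesis by (simp add: eigenvalue[OF s] smult_model_gens mult.commute)
  qed
  then obtain g where g: "g \<in> left_module_hom (hecke q) ind model"
    and g_pure: "\<And>h z. h \<in> carrier (hecke q) \<Longrightarrow>
      g (pure_tensor (hecke q) (parabolic q Node1) (line_module q Node1 \<chi> q) h z)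
        = h \<odot>\<^bsub>model\<^esub> scale4 z (1, 0, 0, 0)"
    using I.T_universal[OF left_module_model, of "\<lambda>z. scale4 z (1, 0, 0, 0)"]
    by (auto simp: line_module_simps line_char_eq induced_def simp del: split_paired_All)
  have comb_e1: "ind.comb (1, 0, 0, 0) = ind_gen" by (rule ind.comb_basis(1))
  have "g ind_gen = (1, 0, 0, 0)"
    unfolding induced_gen_def using g_pure[of "\<one>\<^bsub>hecke q\<^esub>" 1] K.lm_smult_one by simp
  moreover have "g \<zero>\<^bsub>ind\<^esub> = 0"
    using left_module_hom_zero[OF left_module_induced left_module_model g] by simp
  ultimately have "ind_gen \<noteq> \<zero>\<^bsub>ind\<^esub>" by (auto simp: zero_prod_def)
  then have "inj_on ind.comb (carrier model)"
    using irreducible_hom_inj[OF irreducible_model left_module_induced ind.comb_hom, of "(1, 0, 0, 0)"] comb_e1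
    by simp
  moreover have "u \<in> range ind.comb" if "u \<in> carrier ind" for u
    using that
  proof (induction u rule: I.T_induct[folded induced_def, consumes 1, case_names zero diff pure])
    case zero
    show ?case using left_module_hom_zero[OF left_module_model left_module_induced ind.comb_hom]
      by (metis rangeI)
  next
    case (diff u v)
    then obtain u' v' where "u = ind.comb u'" "v = ind.comb v'" by blast
    then show ?case by (simp only: ind.comb_diff rangeI)
  next
    case (pure h z)
    have "pure_tensor (hecke q) (parabolic q Node1) (line_module q Node1 \<chi> q) h z
        = (h \<otimes>\<^bsub>hecke q\<^esub> hscal q z) \<odot>\<^bsub>ind\<^esub> ind.comb (1, 0, 0, 0)"
      using pure smult_ind_gen[of "hscal q z" h] unfolding comb_e1 by (simp add: parabolic_gens eigenvalue_gens)
    also have "\<dots> = ind.comb ((h \<otimes>\<^bsub>hecke q\<^esub> hscal q z) \<odot>\<^bsub>model\<^esub> (1, 0, 0, 0))"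
      using left_module_hom_smult[OF ind.comb_hom] pure by simp
    finally show ?case by (simp only: rangeI)
  qed
  ultimately show ?thesis
    using ind.comb_hom left_module_hom_closed[OF ind.comb_hom] by (auto simp: module_iso_iff bij_betw_def)
qed

lemma irreducible_induced: "irreducible_module (hecke q) ind"
  by (rule irreducible_module_iso[OF left_module_induced module_iso_inv[OF left_module_model induced_iso] irreducible_model])

end

section \<open>Simple modules with the given central character\<close>

context hecke_module
begin

lemma killed_iff:
  assumes "u \<in> carrier L"
  shows "(hX q l \<ominus>\<^bsub>hecke q\<^esub> hscal q z) \<odot>\<^bsub>L\<^esub> u = \<zero>\<^bsub>L\<^esub> \<longleftrightarrow> opX l u = sc z u"
proof -
  have "(hX q l \<ominus>\<^bsub>hecke q\<^esub> hscal q z) \<odot>\<^bsub>L\<^esub> u = opX l u \<ominus>\<^bsub>L\<^esub> sc z u"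
    using assms by (simp add: a_minus_def lm_smult_l_distr smult_l_minus)
  then show ?thesis using assms
    by (metis M.minus_equality M.minus_minus M.r_neg M.a_inv_closed a_minus_def opX_in sc_in)
qed

lemma last_nonzero_power:
  assumes A: "A \<in> carrier (hecke q)" and u: "u \<in> carrier L" "u \<noteq> \<zero>\<^bsub>L\<^esub>"
    and k: "(A [^]\<^bsub>hecke q\<^esub> (k::nat)) \<odot>\<^bsub>L\<^esub> u = \<zero>\<^bsub>L\<^esub>"
  obtains j :: nat where "(A [^]\<^bsub>hecke q\<^esub> j) \<odot>\<^bsub>L\<^esub> u \<noteq> \<zero>\<^bsub>L\<^esub>"
    "A \<odot>\<^bsub>L\<^esub> ((A [^]\<^bsub>hecke q\<^esub> j) \<odot>\<^bsub>L\<^esub> u) = \<zero>\<^bsub>L\<^esub>"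
proof -
  have "\<exists>j. (A [^]\<^bsub>hecke q\<^esub> j) \<odot>\<^bsub>L\<^esub> u \<noteq> \<zero>\<^bsub>L\<^esub> \<and> (A [^]\<^bsub>hecke q\<^esub> Suc j) \<odot>\<^bsub>L\<^esub> u = \<zero>\<^bsub>L\<^esub>"
    using k
  proof (induction k)
    case 0
    then show ?case using u by (simp add: lm_smult_one)
  next
    case (Suc k)
    then show ?case by (cases "(A [^]\<^bsub>hecke q\<^esub> k) \<odot>\<^bsub>L\<^esub> u = \<zero>\<^bsub>L\<^esub>") auto
  qed
  then obtain j where j: "(A [^]\<^bsub>hecke q\<^esub> j) \<odot>\<^bsub>L\<^esub> u \<noteq> \<zero>\<^bsub>L\<^esub>" "(A [^]\<^bsub>hecke q\<^esub> Suc j) \<odot>\<^bsub>L\<^esub> u = \<zero>\<^bsub>L\<^esub>"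
    by blast
  have "A \<odot>\<^bsub>L\<^esub> ((A [^]\<^bsub>hecke q\<^esub> j) \<odot>\<^bsub>L\<^esub> u) = \<zero>\<^bsub>L\<^esub>"
    using j(2) A u by (simp only: hecke.nat_pow_Suc2 lm_smult_assoc hecke.nat_pow_closed)
  with j(1) show thesis by (rule that)
qed

text \<open>The commuting operators \<open>X\<^bsup>\<omega>\<^sub>1\<^esup> - \<psi>(X\<^bsup>\<omega>\<^sub>1\<^esup>)\<close> and \<open>X\<^bsup>\<omega>\<^sub>2\<^esup> - \<psi>(X\<^bsup>\<omega>\<^sub>2\<^esup>)\<close> are nilpotent on a generalized weight
  vector; applying the last nonvanishing power of the one and then of the other leaves a common
  eigenvector.\<close>

lemma weight_has_eigenvector:
  assumes "\<psi> \<in> weights q L"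
  obtains u where "u \<in> carrier L" "u \<noteq> \<zero>\<^bsub>L\<^esub>" "\<And>l. opX l u = sc (\<psi> l) u"
proof -
  define A where "A l = hX q l \<ominus>\<^bsub>hecke q\<^esub> hscal q (\<psi> l)" for l
  have A [simp]: "A l \<in> carrier (hecke q)" for l by (simp add: A_def a_minus_def)
  have shift: "(g \<ominus>\<^bsub>hecke q\<^esub> hscal q z) \<otimes>\<^bsub>hecke q\<^esub> h = h \<otimes>\<^bsub>hecke q\<^esub> (g \<ominus>\<^bsub>hecke q\<^esub> hscal q z)"
    if "g \<otimes>\<^bsub>hecke q\<^esub> h = h \<otimes>\<^bsub>hecke q\<^esub> g" "g \<in> carrier (hecke q)" "h \<in> carrier (hecke q)" for g h z
    using that hscal_central[OF that(3)]
    by (simp add: a_minus_def hecke.l_distr hecke.r_distr hecke.l_minus hecke.r_minus)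
  have "hX q l \<otimes>\<^bsub>hecke q\<^esub> hX q m = hX q m \<otimes>\<^bsub>hecke q\<^esub> hX q l" for l m
    by (simp add: hX_mult add.commute)
  then have "A l \<otimes>\<^bsub>hecke q\<^esub> hX q m = hX q m \<otimes>\<^bsub>hecke q\<^esub> A l" for l m
    unfolding A_def by (intro shift) simp_all
  then have comm: "A l \<otimes>\<^bsub>hecke q\<^esub> A m = A m \<otimes>\<^bsub>hecke q\<^esub> A l" for l m
    using shift[of "hX q m" "A l" "\<psi> m"] by (simp add: A_def[of m])
  have \<psi>: "\<psi> \<in> torus" and gws: "gen_weight_space q L \<psi> \<noteq> {\<zero>\<^bsub>L\<^esub>}"
    using assms by (auto simp: weights_def)
  have gws_eq: "gen_weight_space q L \<psi>
      = {m \<in> carrier L. \<forall>l. \<exists>k>0. (A l [^]\<^bsub>hecke q\<^esub> (k::nat)) \<odot>\<^bsub>L\<^esub> m = \<zero>\<^bsub>L\<^esub>}"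
    by (simp only: gen_weight_space_def A_def)
  have "(A l [^]\<^bsub>hecke q\<^esub> (1::nat)) \<odot>\<^bsub>L\<^esub> \<zero>\<^bsub>L\<^esub> = \<zero>\<^bsub>L\<^esub>" for l by (rule smult_r_null) simp
  then have "\<zero>\<^bsub>L\<^esub> \<in> gen_weight_space q L \<psi>"
    unfolding gws_eq by (blast intro: zero_less_one)
  then obtain m where "m \<in> gen_weight_space q L \<psi>" and m0: "m \<noteq> \<zero>\<^bsub>L\<^esub>"
    using gws by blast
  then have m: "m \<in> carrier L" "m \<noteq> \<zero>\<^bsub>L\<^esub>"
    and nil: "\<And>l. \<exists>k>0. (A l [^]\<^bsub>hecke q\<^esub> (k::nat)) \<odot>\<^bsub>L\<^esub> m = \<zero>\<^bsub>L\<^esub>"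
    unfolding gws_eq by blast+
  obtain k1 k2 :: nat where k1: "(A (1, 0) [^]\<^bsub>hecke q\<^esub> k1) \<odot>\<^bsub>L\<^esub> m = \<zero>\<^bsub>L\<^esub>"
    and k2: "(A (0, 1) [^]\<^bsub>hecke q\<^esub> k2) \<odot>\<^bsub>L\<^esub> m = \<zero>\<^bsub>L\<^esub>"
    using nil[of "(1, 0)"] nil[of "(0, 1)"] by blast
  obtain j :: nat where j: "(A (1, 0) [^]\<^bsub>hecke q\<^esub> j) \<odot>\<^bsub>L\<^esub> m \<noteq> \<zero>\<^bsub>L\<^esub>"
    "A (1, 0) \<odot>\<^bsub>L\<^esub> ((A (1, 0) [^]\<^bsub>hecke q\<^esub> j) \<odot>\<^bsub>L\<^esub> m) = \<zero>\<^bsub>L\<^esub>"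
    by (rule last_nonzero_power[OF A m k1])
  define n where "n = (A (1, 0) [^]\<^bsub>hecke q\<^esub> j) \<odot>\<^bsub>L\<^esub> m"
  have n: "n \<in> carrier L" "n \<noteq> \<zero>\<^bsub>L\<^esub>" using j(1) m by (simp_all add: n_def smult_in)
  have swap: "g \<odot>\<^bsub>L\<^esub> (h \<odot>\<^bsub>L\<^esub> v) = \<zero>\<^bsub>L\<^esub>"
    if "g \<otimes>\<^bsub>hecke q\<^esub> h = h \<otimes>\<^bsub>hecke q\<^esub> g" "g \<odot>\<^bsub>L\<^esub> v = \<zero>\<^bsub>L\<^esub>"
      "g \<in> carrier (hecke q)" "h \<in> carrier (hecke q)" "v \<in> carrier L" for g h v
    using that by (metis lm_smult_assoc smult_r_null)
  have pow_comm: "B [^]\<^bsub>hecke q\<^esub> i \<otimes>\<^bsub>hecke q\<^esub> C = C \<otimes>\<^bsub>hecke q\<^esub> B [^]\<^bsub>hecke q\<^esub> i"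
    if "B \<otimes>\<^bsub>hecke q\<^esub> C = C \<otimes>\<^bsub>hecke q\<^esub> B" "B \<in> carrier (hecke q)" "C \<in> carrier (hecke q)" for B C and i :: nat
    using that by (rule hecke.group_commutes_pow)
  have "(A (0, 1) [^]\<^bsub>hecke q\<^esub> k2) \<odot>\<^bsub>L\<^esub> n = \<zero>\<^bsub>L\<^esub>"
    unfolding n_def
    by (rule swap[OF pow_comm[OF pow_comm[OF comm, symmetric]] k2]) (simp_all add: m)
  then obtain i :: nat where i: "(A (0, 1) [^]\<^bsub>hecke q\<^esub> i) \<odot>\<^bsub>L\<^esub> n \<noteq> \<zero>\<^bsub>L\<^esub>"
    "A (0, 1) \<odot>\<^bsub>L\<^esub> ((A (0, 1) [^]\<^bsub>hecke q\<^esub> i) \<odot>\<^bsub>L\<^esub> n) = \<zero>\<^bsub>L\<^esub>"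
    by (rule last_nonzero_power[OF A n])
  define u where "u = (A (0, 1) [^]\<^bsub>hecke q\<^esub> i) \<odot>\<^bsub>L\<^esub> n"
  have u: "u \<in> carrier L" using n by (simp add: u_def smult_in)
  have "A (1, 0) \<odot>\<^bsub>L\<^esub> u = \<zero>\<^bsub>L\<^esub>"
    unfolding u_def
    by (rule swap[OF pow_comm[OF comm, symmetric] j(2)[folded n_def]]) (simp_all add: n)
  moreover have "A (0, 1) \<odot>\<^bsub>L\<^esub> u = \<zero>\<^bsub>L\<^esub>" using i(2) by (simp add: u_def)
  ultimately have "opX (1, 0) u = sc (\<psi> (1, 0)) u" "opX (0, 1) u = sc (\<psi> (0, 1)) u"
    by (simp_all only: A_def killed_iff[OF u])
  then have "opX l u = sc (\<psi> l) u" for l by (rule eigenvector_all_weights[OF u \<psi>])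
  then show thesis using that[of u] u i(1) by (simp add: u_def)
qed

text \<open>As \<open>(T\<^sub>1 - q)\<^sup>2 = 0\<close>, an eigenvector that \<open>T\<^sub>1 - q\<close> does not kill is mapped by it to
  a \<open>T\<^sub>1\<close>-eigenvector, and the Bernstein relation moves its weight by \<open>s\<^sub>1\<close>.\<close>

lemma weight_vector_exists:
  assumes \<chi>: "special_weight q \<chi>" and u: "u \<in> carrier L" "u \<noteq> \<zero>\<^bsub>L\<^esub>" and w: "\<And>l. opX l u = sc (\<chi> l) u"
  obtains x \<psi> where "\<psi> = \<chi> \<or> \<psi> = \<chi> \<circ> srefl Node1" "weight_vector q \<psi> L x" "x \<noteq> \<zero>\<^bsub>L\<^esub>"
proof (cases "opT Node1 u = sc q u")
  case True
  interpret special_weight q \<chi> by fact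
  have "weight_vector q \<chi> L u" by unfold_locales (use True u w in auto)
  then show thesis using that u by blast
next
  case False
  interpret special_weight q \<chi> by fact
  define x where "x = opT Node1 u \<ominus>\<^bsub>L\<^esub> sc q u"
  have x: "x \<in> carrier L" using u by (simp add: x_def)
  have x_sum: "x = opT Node1 u \<oplus>\<^bsub>L\<^esub> sc (- q) u"
    using u by (simp add: x_def a_minus_def minus_sc sc_sc)
  have lin: "sc a (opT Node1 u) \<oplus>\<^bsub>L\<^esub> sc b u = sc a x" if "b = - (a * q)" for a b
    using u that by (simp add: x_sum lm_smult_r_distr sc_sc)
  have nz: "x \<noteq> \<zero>\<^bsub>L\<^esub>"
    using False u unfolding x_def
    by (metis M.minus_equality M.minus_minus M.a_inv_closed a_minus_def opT_in sc_in)
  have "opT Node1 x = sc q (opT Node1 u) \<oplus>\<^bsub>L\<^esub> sc 1 u"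
  proof -
    have "opT Node1 x = sc (2 * q) (opT Node1 u) \<oplus>\<^bsub>L\<^esub> u \<oplus>\<^bsub>L\<^esub> sc (- q) (opT Node1 u)"
      using u by (simp add: x_sum lm_smult_r_distr op_sc opT_opT inverse_q sc_sc)
    also have "\<dots> = (sc (2 * q) (opT Node1 u) \<oplus>\<^bsub>L\<^esub> sc (- q) (opT Node1 u)) \<oplus>\<^bsub>L\<^esub> u"
      using u by (simp add: M.a_ac)
    finally show ?thesis using u by (simp add: sc_add[symmetric] sc_one)
  qed
  then have T: "opT Node1 x = sc q x" by (simp add: lin q_q)
  have X1: "opX (1, 0) x = sc (- \<chi> (1, 0)) x"
  proof -
    have "opX (1, 0) x = sc (- \<chi> (1, 0)) (opT Node1 u) \<oplus>\<^bsub>L\<^esub> sc (2 * q * \<chi> (1, 0)) u \<oplus>\<^bsub>L\<^esub> sc (- (q * \<chi> (1, 0))) u"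
      using u by (simp add: x_sum lm_smult_r_distr op_sc opX_opT_one w chi_s1_omega1 inverse_q sc_sc)
    also have "\<dots> = sc (- \<chi> (1, 0)) (opT Node1 u) \<oplus>\<^bsub>L\<^esub> sc (q * \<chi> (1, 0)) u"
      using u by (simp add: M.a_assoc sc_add[symmetric])
    finally show ?thesis by (simp add: lin)
  qed
  have X2: "opX (0, 1) x = sc (- 1) x"
  proof -
    have "opX (0, 1) x = sc (- 1) (opT Node1 u) \<oplus>\<^bsub>L\<^esub> sc q u"
      using u by (simp add: x_sum lm_smult_r_distr op_sc opX_opT_zero w chi_omega2 sc_sc)
    then show ?thesis by (simp add: lin)
  qed
  interpret s: special_weight q "\<chi> \<circ> srefl Node1" by (rule reflected)
  have "opX l x = sc ((\<chi> \<circ> srefl Node1) l) x" for l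
    by (rule eigenvector_all_weights[OF x s.torus]) (simp_all add: X1 X2 chi_s1_omega1 chi_s1_omega2)
  then have "weight_vector q (\<chi> \<circ> srefl Node1) L x"
    by unfold_locales (use x T in auto)
  then show thesis using that nz by blast
qed

end

lemma (in special_weight) iso_model_if_eigenvector:
  assumes L: "irreducible_module (hecke q) L" and u: "u \<in> carrier L" "u \<noteq> \<zero>\<^bsub>L\<^esub>"
    and w: "\<And>l. hX q l \<odot>\<^bsub>L\<^esub> u = hscal q (\<chi> l) \<odot>\<^bsub>L\<^esub> u"
  shows "\<exists>f. f \<in> module_iso (hecke q) model L"
proof -
  have lL: "left_module (hecke q) L" using L by (simp add: irreducible_module_def)
  interpret hecke_module q L by (rule hecke_module.intro[OF lL])
  have \<chi>: "special_weight q \<chi>" by unfold_locales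
  obtain x \<psi> where \<psi>: "\<psi> = \<chi> \<or> \<psi> = \<chi> \<circ> srefl Node1" and x: "weight_vector q \<psi> L x" "x \<noteq> \<zero>\<^bsub>L\<^esub>"
    by (rule weight_vector_exists[OF \<chi> u w])
  interpret x: weight_vector q \<psi> L x by fact
  have "x.comb (1, 0, 0, 0) \<noteq> \<zero>\<^bsub>L\<^esub>" using x(2) by (simp only: x.comb_basis not_False_eq_True)
  then have iso: "x.comb \<in> module_iso (hecke q) x.model L"
    by (intro irreducible_hom_is_iso[OF x.irreducible_model L x.comb_hom, of "(1, 0, 0, 0)"]) simp_all
  from \<psi> show ?thesis
  proof
    assume "\<psi> = \<chi>"
    then show ?thesis using iso by blast
  next
    assume "\<psi> = \<chi> \<circ> srefl Node1"
    then show ?thesis using module_iso_comp[OF swap4_iso] iso by blast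
  qed
qed

lemma bij_srefl: "bij (srefl i)"
  by (rule o_bij[of "srefl i"]) (auto simp: fun_eq_iff)

lemma inv_srefl: "inv_into UNIV (srefl i) = srefl i"
  by (rule inv_equality) simp_all

lemma weyl_act_srefl: "weyl_act (srefl i) t = t \<circ> srefl i"
  by (simp add: weyl_act_def comp_def inv_srefl)

lemma bij_weyl: "w \<in> weyl \<Longrightarrow> bij w"
proof (induction rule: weyl.induct)
  case weyl_id
  show ?case by (rule bij_id)
next
  case (weyl_srefl w i)
  then show ?case using bij_srefl bij_comp by blast
qed

lemma weyl_act_srefl_comp:
  assumes "w \<in> weyl"
  shows "weyl_act (srefl i \<circ> w) t = weyl_act w t \<circ> srefl i"
proof -
  have "inv_into UNIV (srefl i \<circ> w) = inv_into UNIV w \<circ> srefl i"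
    using o_inv_distrib[OF bij_srefl bij_weyl[OF assms], of i] by (simp only: inv_srefl)
  then show ?thesis by (simp add: weyl_act_def comp_def)
qed

lemma srefl1_srefl1: "t \<circ> srefl Node1 \<circ> srefl Node1 = t"
  by (simp add: fun_eq_iff)

text \<open>The reflection \<open>s\<^sub>2\<close> fixes both \<open>\<chi>\<close> and \<open>s\<^sub>1\<chi>\<close>.\<close>

lemma (in special_weight) weyl_orbit_subset: "weyl_orbit \<chi> \<subseteq> {\<chi>, \<chi> \<circ> srefl Node1}"
proof -
  have "weyl_act w \<chi> \<in> {\<chi>, \<chi> \<circ> srefl Node1}" if "w \<in> weyl" for w
    using that
  proof (induction rule: weyl.induct)
    case weyl_id
    show ?case by (simp add: weyl_act_def)
  next
    case (weyl_srefl w i)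
    from weyl_srefl.IH show ?case
      unfolding weyl_act_srefl_comp[OF weyl_srefl.hyps]
      by (cases i) (auto simp: fun_eq_iff chi_srefl2 chi_reflected_srefl2 simp del: split_paired_All split_paired_Ex)
  qed
  then show ?thesis by (auto simp: weyl_orbit_def)
qed

section \<open>The induced modules and the classification\<close>

theorem proposition17:
  fixes q :: complex and t :: "wt \<Rightarrow> complex"
    and M N :: "(hecke_elt, induced_elt) module" and v_t v_s1t v :: induced_elt
  assumes q: "q^2 = -1"
    and t: "t \<in> torus" "restricts_to t (q^2) 1"
    and M: "M = induced q Node1 t q" and v_t: "v_t = induced_gen q Node1 t q"
    and N: "N = induced q Node1 (weyl_act (srefl Node1) t) (- inverse q)"
    and v_s1t: "v_s1t = induced_gen q Node1 (weyl_act (srefl Node1) t) (- inverse q)"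
    and v: "v = hT q Node1 \<odot>\<^bsub>M\<^esub> (hT q Node2 \<odot>\<^bsub>M\<^esub> v_t) \<ominus>\<^bsub>M\<^esub> hscal q q \<odot>\<^bsub>M\<^esub> (hT q Node2 \<odot>\<^bsub>M\<^esub> v_t) \<ominus>\<^bsub>M\<^esub> v_t"
  shows "irreducible_module (hecke q) M
    \<and> (\<exists>\<phi> \<in> module_iso (hecke q) N M.
         \<forall>h \<in> carrier (hecke q). \<phi> (h \<odot>\<^bsub>N\<^esub> v_s1t) = h \<odot>\<^bsub>M\<^esub> v)
    \<and> (\<forall>L :: (hecke_elt, 'l) module.
         irreducible_module (hecke q) L \<and> has_central_character q L t \<longrightarrow>
         (\<exists>\<psi>. \<psi> \<in> module_iso (hecke q) L M))"
proof (intro conjI allI impI)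
  have "t (wscale 1 (sroot Node1) + wscale 0 (sroot Node2)) = q\<^sup>2 powi 1 * 1 powi 0"
    "t (wscale 0 (sroot Node1) + wscale 1 (sroot Node2)) = q\<^sup>2 powi 0 * 1 powi 1"
    using t(2) by (simp_all only: restricts_to_def)
  then interpret special_weight q t
    using q t(1) by unfold_locales (simp_all add: wscale_def)
  interpret s: special_weight q "t \<circ> srefl Node1" by (rule reflected)
  have N_eq: "N = s.ind" and gen_eq: "v_s1t = s.ind_gen"
    by (simp_all add: N v_s1t weyl_act_srefl inverse_q)
  show "irreducible_module (hecke q) M" unfolding M by (rule irreducible_induced)
  have M_iso: "ind.comb \<in> module_iso (hecke q) model M" unfolding M by (rule induced_iso)
  show "\<exists>\<phi> \<in> module_iso (hecke q) N M. \<forall>h \<in> carrier (hecke q). \<phi> (h \<odot>\<^bsub>N\<^esub> v_s1t) = h \<odot>\<^bsub>M\<^esub> v"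
  proof (intro bexI ballI)
    \<comment> \<open>Through the models, the generator of \<open>N\<close> is the first basis vector for \<open>s\<^sub>1t\<close>; the exchange of
      the halves makes it the third one for \<open>t\<close>, which is \<open>v\<close>.\<close>
    let ?g = "inv_into (carrier s.model) s.ind.comb"
    let ?\<phi> = "ind.comb \<circ> (swap4 \<circ> ?g)"
    have g: "?g \<in> module_iso (hecke q) N s.model"
      unfolding N_eq by (rule module_iso_inv[OF s.left_module_model s.induced_iso])
    have "swap4 \<in> module_iso (hecke q) s.model model"
      using s.swap4_iso by (simp only: srefl1_srefl1)
    from module_iso_comp[OF module_iso_comp[OF g this] M_iso]
    show \<phi>: "?\<phi> \<in> module_iso (hecke q) N M" .
    have "?g v_s1t = (1, 0, 0, 0)"
      using s.induced_iso s.ind.comb_basis(1) unfolding gen_eq module_iso_iff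
      by (metis UNIV_I bij_betw_imp_inj_on inv_into_f_f s.model_simps(1))
    then have "?\<phi> v_s1t = ind.y" by (simp add: ind.comb_basis del: ind.comb.simps)
    also have "\<dots> = v" by (simp add: ind.y_def v M v_t)
    finally have *: "?\<phi> v_s1t = v" .
    fix h assume h: "h \<in> carrier (hecke q)"
    have "v_s1t \<in> carrier N" by (simp only: N_eq gen_eq s.ind.x)
    moreover have "?\<phi> \<in> left_module_hom (hecke q) N M" using \<phi> by (simp only: module_iso_iff)
    ultimately have "?\<phi> (h \<odot>\<^bsub>N\<^esub> v_s1t) = h \<odot>\<^bsub>M\<^esub> ?\<phi> v_s1t" using h by (intro left_module_hom_smult)
    then show "?\<phi> (h \<odot>\<^bsub>N\<^esub> v_s1t) = h \<odot>\<^bsub>M\<^esub> v" by (simp only: *)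
  qed
  fix L :: "(hecke_elt, 'l) module"
  assume L: "irreducible_module (hecke q) L \<and> has_central_character q L t"
  then have lL: "left_module (hecke q) L" by (simp add: irreducible_module_def)
  interpret L: hecke_module q L by (rule hecke_module.intro[OF lL])
  obtain \<psi> where "\<psi> \<in> weights q L" and \<psi>: "\<psi> = t \<or> \<psi> = t \<circ> srefl Node1"
    using L weyl_orbit_subset by (auto simp: has_central_character_def)
  then obtain u where u: "u \<in> carrier L" "u \<noteq> \<zero>\<^bsub>L\<^esub>" "\<And>l. L.opX l u = L.sc (\<psi> l) u"
    using L.weight_has_eigenvector by metis
  have "\<exists>f. f \<in> module_iso (hecke q) model L"
    using \<psi>
  proof
    assume "\<psi> = t"
    then show ?thesis using iso_model_if_eigenvector[OF _ u(1,2)] u(3) L by blast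
  next
    assume "\<psi> = t \<circ> srefl Node1"
    then obtain f where "f \<in> module_iso (hecke q) s.model L"
      using s.iso_model_if_eigenvector[OF _ u(1,2)] u(3) L by blast
    then show ?thesis using module_iso_comp[OF swap4_iso] by blast
  qed
  then obtain f where "f \<in> module_iso (hecke q) model L" ..
  from module_iso_comp[OF module_iso_inv[OF left_module_model this] M_iso]
  show "\<exists>\<psi>. \<psi> \<in> module_iso (hecke q) L M" by blast
qed

end
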